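(* Let $X$ be an infinite-dimensional Banach space and let $T$ be a bounded operator on $X$. The following assertions are equivalent: (a) $T$ is super-ergodic. (b) For all $\varepsilon>0$, the tree $\mathcal A_e(T,\varepsilon)$ is well founded. (c) $\eta_e(T):=\sup_{\varepsilon>0}h\big(\mathcal A_e(T,\varepsilon)\big)<\omega_1$, where $h$ gives the height of a tree.
   Context: For $n\ge1$, the $n$-th Cesaro-mean of $T$ is $A_n=\frac1n\sum_{k=0}^{n-1}T^k$. $T$ is ergodic if $(A_n)_n$ converges in $L(X)$ (the bounded operators on $X$) for the strong operator topology. For an ultrafilter $\mathcal U$ on $\mathbb N$, let $X_{\mathcal U}=\ell^\infty(X)/\mathcal C_{\mathcal U}(X)$, where $\ell^\infty(X)$ is the Banach space of bounded sequences in $X$ and $\mathcal C_{\mathcal U}(X)$ is the subspace of sequences $(x_n)$ with $\lim_{\mathcal U}\|x_n\|=0$; the ultrapower operator is $T_{\mathcal U}\big((x_n)_n+\mathcal C_{\mathcal U}(X)\big)=(Tx_n)_n+\mathcal C_{\mathcal U}(X)$. $T$ is super-ergodic if $T_{\mathcal U}$ is ergodic on $X_{\mathcal U}$ for every ultrafilter $\mathcal U$ on $\mathbb N$. $\mathbb N=\{1,2,\dots\}$. $\mathbb N^{\uparrow<\mathbb N}$ is the set of finite strictly increasing sequences in $\mathbb N$, including the empty sequence; $|s|$ is the length of $s$ and $s_p$ its $p$-th element. $B_X$ is the closed unit ball of $X$. For $\varepsilon>0$, $\mathcal A_e(T,\varepsilon)$ is the tree on $\mathbb N$ consisting of all $s\in\mathbb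 N^{\uparrow<\mathbb N}$ such that $|s|\le1$, or there exists $x\in B_X$ with $\|A_{s_p}x-A_{s_{p+1}}x\|>\varepsilon$ for all $1\le p<|s|$. A tree on $\mathbb N$ is a set of finite sequences in $\mathbb N$ closed under initial segments; it is well founded if it has no infinite branch. Height of a tree $\mathcal T$: put $\mathcal T^{(0)}=\mathcal T$, $\mathcal T^{(\alpha+1)}=\{s:\ s \text{ has a proper extension in }\mathcal T^{(\alpha)}\}$, $\mathcal T^{(\lambda)}=\bigcap_{\alpha<\lambda}\mathcal T^{(\alpha)}$ for limit $\lambda$; $h(\mathcal T)$ is the least $\alpha$ with $\mathcal T^{(\alpha)}=\emptyset$ if such an $\alpha$ exists, and $h(\mathcal T)=\omega_1$ otherwise. *)

theory Defs
  imports "HOL-Analysis.Analysis" "HOL-Library.Sublist"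
begin

section \<open>Ordinals\<close>

text \<open>
  The derivatives and the height of a tree need ordinals up to and including \<open>\<omega>\<^sub>1\<close>. The type below
  consists of the ordinals smaller than \<open>\<omega>\<^sub>2\<close>: it is the well-order \<open>cardSuc (cardSuc natLeq)\<close>, the
  second cardinal successor of \<open>\<aleph>\<^sub>0\<close>. The derivatives of a tree on a countable set are stationary
  from some countable stage on, so that no later ordinal is needed.
\<close>

abbreviation omega2_rel :: "nat set set rel" where
  "omega2_rel \<equiv> cardSuc (cardSuc natLeq)"

lemma Card_order_omega1_rel: "Card_order (cardSuc natLeq)"
  by (simp add: cardSuc_Card_order natLeq_Card_order)

lemma Card_order_omega2_rel: "Card_order omega2_rel"
  by (simp add: cardSuc_Card_order Card_order_omega1_rel)

lemma Well_order_omega2_rel: "Well_order omega2_rel"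
  using Card_order_omega2_rel card_order_on_def by blast

lemma infinite_Field_omega1_rel: "infinite (Field (cardSuc natLeq))"
  by (simp only: cardSuc_finite[OF natLeq_Card_order] Field_natLeq infinite_UNIV_nat not_False_eq_True)

lemma infinite_Field_omega2_rel: "infinite (Field omega2_rel)"
  by (simp add: cardSuc_finite Card_order_omega1_rel infinite_Field_omega1_rel)

typedef ordinal = "Field omega2_rel"
  using infinite_Field_omega2_rel by (metis finite.emptyI ex_in_conv)

instantiation ordinal :: wellorder
begin

definition less_eq_ordinal :: "ordinal \<Rightarrow> ordinal \<Rightarrow> bool" where
  "\<alpha> \<le> \<beta> \<longleftrightarrow> (Rep_ordinal \<alpha>, Rep_ordinal \<beta>) \<in> omega2_rel"

definition less_ordinal :: "ordinal \<Rightarrow> ordinal \<Rightarrow> bool" where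
  "\<alpha> < \<beta> \<longleftrightarrow> \<alpha> \<le> \<beta> \<and> \<alpha> \<noteq> (\<beta> :: ordinal)"

instance
proof
  have refl: "(a, a) \<in> omega2_rel" if "a \<in> Field omega2_rel" for a
    using Well_order_omega2_rel that
    by (auto simp: well_order_on_def linear_order_on_def partial_order_on_def preorder_on_def
        refl_on_def)
  have antisym: "antisym omega2_rel" and trans: "trans omega2_rel"
    and total: "total_on (Field omega2_rel) omega2_rel" and wf: "wf (omega2_rel - Id)"
    using Well_order_omega2_rel
    by (auto simp: well_order_on_def linear_order_on_def partial_order_on_def preorder_on_def)
  fix x y z :: ordinal
  show "x \<le> x"
    by (simp add: less_eq_ordinal_def refl Rep_ordinal)
  show antisym': "x = y" if "x \<le> y" "y \<le> x"
    using antisymD[OF antisym] that by (simp add: less_eq_ordinal_def flip: Rep_ordinal_inject)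
  show "x \<le> z" if "x \<le> y" "y \<le> z"
    using that transD[OF trans] unfolding less_eq_ordinal_def by blast
  show "x \<le> y \<or> y \<le> x"
    using total Rep_ordinal[of x] Rep_ordinal[of y] refl unfolding less_eq_ordinal_def total_on_def
    by (cases "Rep_ordinal x = Rep_ordinal y") auto
  show "(x < y) = (x \<le> y \<and> \<not> y \<le> x)"
    using antisymD[OF antisym, of "Rep_ordinal x" "Rep_ordinal y"] refl[OF Rep_ordinal[of x]]
    by (auto simp: less_ordinal_def less_eq_ordinal_def Rep_ordinal_inject)
  fix P :: "ordinal \<Rightarrow> bool" and a :: ordinal
  assume step: "\<And>x. (\<And>y. y < x \<Longrightarrow> P y) \<Longrightarrow> P x"
  have "wf {(x :: ordinal, y). x < y}"
  proof (rule wf_subset[OF wf_inv_image[OF wf, of Rep_ordinal]])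
    show "{(x :: ordinal, y). x < y} \<subseteq> inv_image (omega2_rel - Id) Rep_ordinal"
      by (auto simp: less_ordinal_def less_eq_ordinal_def inv_image_def Rep_ordinal_inject)
  qed
  then show "P a"
    by (induction a rule: wf_induct_rule) (use step in auto)
qed

end

instantiation ordinal :: "{order_bot, Sup, Inf}"
begin

definition bot_ordinal :: ordinal where
  "bot = (LEAST \<alpha> :: ordinal. True)"

definition Sup_ordinal :: "ordinal set \<Rightarrow> ordinal" where
  "Sup A = (LEAST \<beta> :: ordinal. \<forall>\<alpha>\<in>A. \<alpha> \<le> \<beta>)"

definition Inf_ordinal :: "ordinal set \<Rightarrow> ordinal" where
  "Inf A = (LEAST \<alpha> :: ordinal. \<alpha> \<in> A)"

instance
  by standard (simp add: bot_ordinal_def Least_le)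

end

instantiation ordinal :: conditionally_complete_linorder
begin

definition inf_ordinal :: "ordinal \<Rightarrow> ordinal \<Rightarrow> ordinal" where
  "inf_ordinal = min"

definition sup_ordinal :: "ordinal \<Rightarrow> ordinal \<Rightarrow> ordinal" where
  "sup_ordinal = max"

instance
proof
  fix x z :: ordinal and X :: "ordinal set"
  show "Inf X \<le> x" if "x \<in> X"
    using that by (simp add: Inf_ordinal_def Least_le)
  show "z \<le> Inf X" if "X \<noteq> {}" "\<And>x. x \<in> X \<Longrightarrow> z \<le> x"
    using that by (metis Inf_ordinal_def LeastI ex_in_conv)
  show "x \<le> Sup X" if "x \<in> X" "bdd_above X"
  proof -
    from that(2) obtain b where "\<forall>\<alpha>\<in>X. \<alpha> \<le> b"
      by (auto simp: bdd_above_def)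
    then have "\<forall>\<alpha>\<in>X. \<alpha> \<le> Sup X"
      unfolding Sup_ordinal_def by (rule LeastI)
    with that(1) show ?thesis by blast
  qed
  show "Sup X \<le> z" if "X \<noteq> {}" "\<And>x. x \<in> X \<Longrightarrow> x \<le> z"
    unfolding Sup_ordinal_def using that(2) by (simp add: Least_le)
qed (auto simp: inf_ordinal_def sup_ordinal_def)

end

definition ord_succ :: "ordinal \<Rightarrow> ordinal" where
  "ord_succ \<alpha> = (LEAST \<beta>. \<alpha> < \<beta>)"

definition omega1 :: ordinal where
  "omega1 = (LEAST \<alpha>. uncountable {..<\<alpha>})"

lemma ordinal_no_max: "\<exists>\<beta>. (\<alpha> :: ordinal) < \<beta>"
proof -
  obtain b where b: "b \<in> Field omega2_rel" "Rep_ordinal \<alpha> \<noteq> b" "(Rep_ordinal \<alpha>, b) \<in> omega2_rel"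
    using infinite_Card_order_limit[OF Card_order_omega2_rel infinite_Field_omega2_rel Rep_ordinal]
    by blast
  then have "\<alpha> < Abs_ordinal b"
    by (metis Abs_ordinal_inverse less_eq_ordinal_def less_ordinal_def)
  then show ?thesis by blast
qed

lemma less_ord_succ: "\<alpha> < ord_succ \<alpha>"
  unfolding ord_succ_def using ordinal_no_max by (rule LeastI_ex)

lemma ord_succ_le_iff: "ord_succ \<alpha> \<le> \<beta> \<longleftrightarrow> \<alpha> < \<beta>"
  using less_ord_succ[of \<alpha>] by (auto simp: ord_succ_def Least_le intro: less_le_trans)

lemma ord_succ_inject: "ord_succ \<alpha> = ord_succ \<beta> \<longleftrightarrow> \<alpha> = \<beta>"
  by (metis less_ord_succ linorder_neqE not_less ord_succ_le_iff)

lemma uncountable_below_omega1: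
  includes cardinal_syntax
  shows "uncountable {..<omega1}"
proof -
  have wo1: "Well_order (cardSuc natLeq)"
    using Card_order_omega1_rel card_order_on_def by blast
  have "cardSuc natLeq <o omega2_rel"
    by (rule cardSuc_greater[OF Card_order_omega1_rel])
  then obtain a where a: "a \<in> Field omega2_rel"
      "cardSuc natLeq =o Restr omega2_rel (underS omega2_rel a)"
    using ordLess_iff_ordIso_Restr[OF Well_order_omega2_rel wo1] by blast
  have "cardSuc natLeq =o |Field (cardSuc natLeq)|"
    using Card_order_omega1_rel card_of_Field_ordIso ordIso_symmetric by blast
  moreover have "\<not> cardSuc natLeq \<le>o natLeq"
    using cardSuc_greater[OF natLeq_Card_order] not_ordLess_ordLeq by blast
  ultimately have "\<not> |Field (cardSuc natLeq)| \<le>o natLeq"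
    using ordIso_ordLeq_trans by blast
  then have unc: "uncountable (Field (cardSuc natLeq))"
    using card_of_ordLeq card_of_nat ordLeq_ordIso_trans by (metis countable_def subset_UNIV)
  obtain f where "bij_betw f (Field (cardSuc natLeq))
      (Field (Restr omega2_rel (underS omega2_rel a)))"
    using a(2) by (auto simp: ordIso_def iso_def)
  then have "uncountable (Field (Restr omega2_rel (underS omega2_rel a)))"
    using unc countable_image_inj_on by (metis bij_betw_def)
  moreover have "Field (Restr omega2_rel (underS omega2_rel a))
      \<subseteq> Rep_ordinal ` {..<Abs_ordinal a}"
  proof
    fix b assume "b \<in> Field (Restr omega2_rel (underS omega2_rel a))"
    then have b: "b \<noteq> a" "(b, a) \<in> omega2_rel"
      by (auto simp: Field_def underS_def)
    then have b': "b \<in> Field omega2_rel"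
      by (auto simp: Field_def)
    then have "Abs_ordinal b < Abs_ordinal a"
      using a(1) b by (simp add: less_ordinal_def less_eq_ordinal_def Abs_ordinal_inverse
          Abs_ordinal_inject)
    then show "b \<in> Rep_ordinal ` {..<Abs_ordinal a}"
      using b' by (metis Abs_ordinal_inverse imageI lessThan_iff)
  qed
  ultimately have "uncountable {..<Abs_ordinal a}"
    by (meson countable_image countable_subset)
  then show ?thesis
    unfolding omega1_def by (rule LeastI)
qed

section \<open>Trees\<close>

text \<open>
  Finite sequences in \<open>\<nat>\<close> are lists; the \<open>p\<close>-th element \<open>s\<^sub>p\<close> (\<open>p = 1, 2, \<dots>\<close>) is \<open>s ! (p - 1)\<close>.
\<close>

definition well_founded_tree :: "nat list set \<Rightarrow> bool" where
  "well_founded_tree \<T> \<longleftrightarrow> \<not> (\<exists>b :: nat \<Rightarrow> nat. \<forall>n. map b [0..<n] \<in> \<T>)"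

function tree_deriv :: "nat list set \<Rightarrow> ordinal \<Rightarrow> nat list set" where
  "tree_deriv \<T> \<alpha> =
    (if \<alpha> = bot then \<T>
     else if \<exists>\<beta>. \<alpha> = ord_succ \<beta>
       then {s. \<exists>t \<in> tree_deriv \<T> (SOME \<beta>. \<alpha> = ord_succ \<beta>). strict_prefix s t}
     else (\<Inter>\<beta>\<in>{..<\<alpha>}. tree_deriv \<T> \<beta>))"
  by auto
termination
proof (relation "inv_image {(x, y). x < y} snd")
  show "wf (inv_image {(x :: ordinal, y). x < y} (snd :: nat list set \<times> ordinal \<Rightarrow> ordinal))"
    by (intro wf_inv_image wf)
next
  fix \<T> :: "nat list set" and \<alpha> :: ordinal
  assume "\<exists>\<beta>. \<alpha> = ord_succ \<beta>"
  then have "\<alpha> = ord_succ (SOME \<beta>. \<alpha> = ord_succ \<beta>)"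
    by (rule someI_ex)
  then show "((\<T>, SOME \<beta>. \<alpha> = ord_succ \<beta>), \<T>, \<alpha>) \<in> inv_image {(x, y). x < y} snd"
    using less_ord_succ by (metis (mono_tags, lifting) case_prodI in_inv_image mem_Collect_eq snd_conv)
qed auto

declare tree_deriv.simps [simp del]

lemma tree_deriv_zero: "tree_deriv \<T> bot = \<T>"
  by (simp add: tree_deriv.simps)

lemma tree_deriv_succ:
  "tree_deriv \<T> (ord_succ \<alpha>) = {s. \<exists>t \<in> tree_deriv \<T> \<alpha>. strict_prefix s t}"
proof -
  have "ord_succ \<alpha> \<noteq> bot"
    using less_ord_succ[of \<alpha>] by auto
  then show ?thesis
    by (subst tree_deriv.simps) (simp add: ord_succ_inject)
qed

lemma tree_deriv_limit:
  assumes "\<alpha> \<noteq> bot" and "\<And>\<beta>. \<alpha> \<noteq> ord_succ \<beta>"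
  shows "tree_deriv \<T> \<alpha> = (\<Inter>\<beta>\<in>{..<\<alpha>}. tree_deriv \<T> \<beta>)"
  using assms by (subst tree_deriv.simps) simp

definition tree_height :: "nat list set \<Rightarrow> ordinal" where
  "tree_height \<T> =
    (if \<exists>\<alpha>. tree_deriv \<T> \<alpha> = {} then LEAST \<alpha>. tree_deriv \<T> \<alpha> = {} else omega1)"

section \<open>Cesaro means and the associated trees\<close>

definition cesaro :: "('a :: real_vector \<Rightarrow> 'a) \<Rightarrow> nat \<Rightarrow> 'a \<Rightarrow> 'a" where
  "cesaro T n x = (1 / real n) *\<^sub>R (\<Sum>k<n. (T ^^ k) x)"

definition ergodic_tree :: "('a :: real_normed_vector \<Rightarrow> 'a) \<Rightarrow> real \<Rightarrow> nat list set" where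
  "ergodic_tree T \<epsilon> =
    {s. set s \<subseteq> {1..} \<and> sorted_wrt (<) s \<and>
        (length s \<le> 1 \<or>
         (\<exists>x\<in>cball 0 1. \<forall>p. Suc p < length s \<longrightarrow>
            norm (cesaro T (s ! p) x - cesaro T (s ! Suc p) x) > \<epsilon>))}"

text \<open>
  The order on the ordinals below \<open>\<omega>\<^sub>2\<close> is only conditionally complete; the supremum is meaningful because
  the height of a tree is at most \<open>\<omega>\<^sub>1\<close>.
\<close>

definition ergodic_height :: "('a :: real_normed_vector \<Rightarrow> 'a) \<Rightarrow> ordinal" where
  "ergodic_height T = (SUP \<epsilon>\<in>{0<..}. tree_height (ergodic_tree T \<epsilon>))"

section \<open>Ergodic operators on a normed space with explicit carrier\<close>

text \<open>
  The ultrapower depends on an ultrafilter, which is a value, and so it cannot be a type. Normed spaces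
  are therefore given here by an explicit carrier set together with their operations.
\<close>

record 'v nspace =
  nsp_carrier :: "'v set"
  nsp_zero :: 'v
  nsp_add :: "'v \<Rightarrow> 'v \<Rightarrow> 'v"
  nsp_scale :: "real \<Rightarrow> 'v \<Rightarrow> 'v"
  nsp_norm :: "'v \<Rightarrow> real"

primrec nsp_sum :: "'v nspace \<Rightarrow> (nat \<Rightarrow> 'v) \<Rightarrow> nat \<Rightarrow> 'v" where
  "nsp_sum N f 0 = nsp_zero N"
| "nsp_sum N f (Suc n) = nsp_add N (nsp_sum N f n) (f n)"

definition nsp_diff :: "'v nspace \<Rightarrow> 'v \<Rightarrow> 'v \<Rightarrow> 'v" where
  "nsp_diff N \<xi> \<eta> = nsp_add N \<xi> (nsp_scale N (-1) \<eta>)"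

definition nsp_cesaro :: "'v nspace \<Rightarrow> ('v \<Rightarrow> 'v) \<Rightarrow> nat \<Rightarrow> 'v \<Rightarrow> 'v" where
  "nsp_cesaro N T n \<xi> = nsp_scale N (1 / real n) (nsp_sum N (\<lambda>k. (T ^^ k) \<xi>) n)"

definition nsp_bounded_linear :: "'v nspace \<Rightarrow> ('v \<Rightarrow> 'v) \<Rightarrow> bool" where
  "nsp_bounded_linear N P \<longleftrightarrow>
    P \<in> nsp_carrier N \<rightarrow> nsp_carrier N \<and>
    (\<forall>\<xi>\<in>nsp_carrier N. \<forall>\<eta>\<in>nsp_carrier N. P (nsp_add N \<xi> \<eta>) = nsp_add N (P \<xi>) (P \<eta>)) \<and>
    (\<forall>c. \<forall>\<xi>\<in>nsp_carrier N. P (nsp_scale N c \<xi>) = nsp_scale N c (P \<xi>)) \<and>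
    (\<exists>K. \<forall>\<xi>\<in>nsp_carrier N. nsp_norm N (P \<xi>) \<le> K * nsp_norm N \<xi>)"

definition nsp_ergodic :: "'v nspace \<Rightarrow> ('v \<Rightarrow> 'v) \<Rightarrow> bool" where
  "nsp_ergodic N T \<longleftrightarrow>
    (\<exists>P. nsp_bounded_linear N P \<and>
      (\<forall>\<xi>\<in>nsp_carrier N. (\<lambda>n. nsp_norm N (nsp_diff N (nsp_cesaro N T n \<xi>) (P \<xi>))) \<longlonglongrightarrow> 0))"

section \<open>Quotients of normed spaces\<close>

text \<open>
  The elements of the quotient of a normed space by a subspace \<open>M\<close> are the cosets of \<open>M\<close>; operations
  are defined on representatives, in the style of \<open>HOL.Equiv_Relations\<close>, as unions of sets that do not
  depend on the chosen representatives.
\<close>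

definition qcoset :: "'v :: real_vector set \<Rightarrow> 'v \<Rightarrow> 'v set" where
  "qcoset M x = (\<lambda>m. x + m) ` M"

definition quotient_nspace :: "'v :: real_normed_vector set \<Rightarrow> 'v set nspace" where
  "quotient_nspace M =
    \<lparr> nsp_carrier = range (qcoset M),
      nsp_zero = qcoset M 0,
      nsp_add = (\<lambda>\<xi> \<eta>. \<Union>x\<in>\<xi>. \<Union>y\<in>\<eta>. qcoset M (x + y)),
      nsp_scale = (\<lambda>c \<xi>. \<Union>x\<in>\<xi>. qcoset M (c *\<^sub>R x)),
      nsp_norm = (\<lambda>\<xi>. INF x\<in>\<xi>. norm x) \<rparr>"

definition quotient_map :: "'v :: real_vector set \<Rightarrow> ('v \<Rightarrow> 'v) \<Rightarrow> 'v set \<Rightarrow> 'v set" where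
  "quotient_map M S \<xi> = (\<Union>x\<in>\<xi>. qcoset M (S x))"

lemma qcoset_eq_iff:
  assumes "subspace M"
  shows "qcoset M x = qcoset M y \<longleftrightarrow> x - y \<in> M"
proof
  assume "qcoset M x = qcoset M y"
  moreover have "x \<in> qcoset M x"
    using subspace_0[OF assms] by (force simp: qcoset_def)
  ultimately show "x - y \<in> M"
    by (auto simp: qcoset_def)
next
  assume xy: "x - y \<in> M"
  have "qcoset M a \<subseteq> qcoset M b" if "a - b \<in> M" for a b
  proof
    fix z assume "z \<in> qcoset M a"
    then obtain m where m: "m \<in> M" "z = b + ((a - b) + m)"
      by (auto simp: qcoset_def)
    show "z \<in> qcoset M b"
      unfolding qcoset_def m(2) using subspace_add[OF assms that m(1)] by (rule imageI)
  qed
  moreover have "y - x \<in> M"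
    using subspace_neg[OF assms xy] by simp
  ultimately show "qcoset M x = qcoset M y"
    using xy by blast
qed

lemma quotient_map_qcoset:
  assumes "subspace M" "linear S" "S ` M \<subseteq> M"
  shows "quotient_map M S (qcoset M x) = qcoset M (S x)"
proof -
  have "qcoset M (S y) = qcoset M (S x)" if "y \<in> qcoset M x" for y
    using that assms by (auto simp: qcoset_def[of M x] qcoset_eq_iff linear_add)
  moreover have "x \<in> qcoset M x"
    using subspace_0[OF assms(1)] by (force simp: qcoset_def)
  ultimately show ?thesis
    unfolding quotient_map_def by (intro UN_constant_eq ballI)
qed

lemma quotient_scale_qcoset:
  assumes "subspace M"
  shows "nsp_scale (quotient_nspace M) c (qcoset M x) = qcoset M (c *\<^sub>R x)"
proof -
  have "(*\<^sub>R) c ` M \<subseteq> M"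
    using subspace_scale[OF assms] by blast
  then show ?thesis
    using quotient_map_qcoset[OF assms linear_scale_self, of c x]
    by (simp add: quotient_nspace_def quotient_map_def)
qed

lemma quotient_add_qcoset:
  assumes "subspace M"
  shows "nsp_add (quotient_nspace M) (qcoset M x) (qcoset M y) = qcoset M (x + y)"
proof -
  have "qcoset M (u + v) = qcoset M (x + y)" if "u \<in> qcoset M x" "v \<in> qcoset M y" for u v
  proof -
    from that obtain m m' where "m \<in> M" "m' \<in> M" "(u + v) - (x + y) = m + m'"
      by (auto simp: qcoset_def)
    then show ?thesis
      using assms by (simp add: qcoset_eq_iff subspace_add)
  qed
  moreover have xy: "x \<in> qcoset M x" "y \<in> qcoset M y"
    using subspace_0[OF assms(1)] by (force simp: qcoset_def)+
  ultimately have "(\<Union>v\<in>qcoset M y. qcoset M (u + v)) = qcoset M (x + y)" if "u \<in> qcoset M x" for u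
    using that by (intro UN_constant_eq ballI)
  then have "(\<Union>u\<in>qcoset M x. \<Union>v\<in>qcoset M y. qcoset M (u + v)) = qcoset M (x + y)"
    by (intro UN_constant_eq[OF xy(1)] ballI)
  then show ?thesis
    by (simp add: quotient_nspace_def)
qed

section \<open>Ultrapowers\<close>

text \<open>
  Sequences and ultrafilters are indexed by the type \<open>nat\<close>, which replaces \<open>{1, 2, \<dots>}\<close> through
  the bijection \<open>n \<mapsto> n + 1\<close>; the index set enters only as a countably infinite set. Principal ultrafilters
  are included. As \<open>nat\<close> is discrete, the type \<open>nat \<Rightarrow>\<^sub>C 'a\<close> of bounded continuous functions with the
  supremum norm is the space of bounded sequences.
\<close>

definition ultrafilter :: "'i filter \<Rightarrow> bool" where
  "ultrafilter U \<longleftrightarrow> U \<noteq> bot \<and> (\<forall>P. eventually P U \<or> eventually (\<lambda>i. \<not> P i) U)"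

definition null_sequences :: "nat filter \<Rightarrow> (nat \<Rightarrow>\<^sub>C 'a :: real_normed_vector) set" where
  "null_sequences U = {x. ((\<lambda>n. norm (apply_bcontfun x n)) \<longlongrightarrow> 0) U}"

definition ultrapower :: "nat filter \<Rightarrow> (nat \<Rightarrow>\<^sub>C 'a :: real_normed_vector) set nspace" where
  "ultrapower U = quotient_nspace (null_sequences U)"

definition sequence_map ::
  "('a :: real_normed_vector \<Rightarrow> 'a) \<Rightarrow> (nat \<Rightarrow>\<^sub>C 'a) \<Rightarrow> (nat \<Rightarrow>\<^sub>C 'a)" where
  "sequence_map T x = Bcontfun (\<lambda>n. T (apply_bcontfun x n))"

definition ultrapower_map :: "nat filter \<Rightarrow> ('a :: real_normed_vector \<Rightarrow> 'a) \<Rightarrow>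
    (nat \<Rightarrow>\<^sub>C 'a) set \<Rightarrow> (nat \<Rightarrow>\<^sub>C 'a) set" where
  "ultrapower_map U T = quotient_map (null_sequences U) (sequence_map T)"

lemma subspace_null_sequences: "subspace (null_sequences U)"
proof (rule subspaceI)
  show "0 \<in> null_sequences U"
    by (simp add: null_sequences_def)
next
  fix x y :: "nat \<Rightarrow>\<^sub>C 'a" assume "x \<in> null_sequences U" "y \<in> null_sequences U"
  then show "x + y \<in> null_sequences U"
    using tendsto_add[of "apply_bcontfun x" 0 U "apply_bcontfun y" 0]
    by (simp add: null_sequences_def tendsto_norm_zero_iff)
next
  fix c and x :: "nat \<Rightarrow>\<^sub>C 'a" assume "x \<in> null_sequences U"
  then show "c *\<^sub>R x \<in> null_sequences U"
    using tendsto_scaleR[OF tendsto_const[of c U], of "apply_bcontfun x" 0]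
    by (simp add: null_sequences_def tendsto_norm_zero_iff del: norm_scaleR)
qed

lemma apply_sequence_map:
  assumes "bounded_linear T"
  shows "apply_bcontfun (sequence_map T x) n = T (apply_bcontfun x n)"
proof -
  have "bounded (T ` range (apply_bcontfun x))"
    by (rule bounded_linear_image[OF bounded_apply_bcontfun assms])
  then have "(\<lambda>n. T (apply_bcontfun x n)) \<in> bcontfun"
    by (simp add: bcontfun_def image_image continuous_on_discrete)
  then show ?thesis
    by (simp add: sequence_map_def Bcontfun_inverse)
qed

lemma ultrapower_map_qcoset:
  assumes "bounded_linear T"
  shows "ultrapower_map U T (qcoset (null_sequences U) x)
    = qcoset (null_sequences U) (sequence_map T x)"
  unfolding ultrapower_map_def
proof (rule quotient_map_qcoset[OF subspace_null_sequences])
  interpret T: bounded_linear T by fact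
  show "linear (sequence_map T)"
    by (rule linearI)
      (auto intro!: bcontfun_eqI simp: apply_sequence_map[OF assms] T.add T.scale)
  show "sequence_map T ` null_sequences U \<subseteq> null_sequences U"
    using T.tendsto_zero
    by (auto simp: null_sequences_def apply_sequence_map[OF assms] tendsto_norm_zero_iff)
qed

definition super_ergodic :: "('a :: real_normed_vector \<Rightarrow> 'a) \<Rightarrow> bool" where
  "super_ergodic T \<longleftrightarrow>
    (\<forall>U :: nat filter. ultrafilter U \<longrightarrow> nsp_ergodic (ultrapower U) (ultrapower_map U T))"

end

(* An infinite branch b of the tree with parameter e yields vectors x_i in the unit ball whose Cesaro means
   oscillate by more than e along b(0), ..., b(i - 1); the class of (x_i) in the ultrapower along a
   free ultrafilter then has a non-Cauchy sequence of Cesaro means. Conversely, if the Cesaro means of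
   the class of a bounded sequence x are not Cauchy, they oscillate along some increasing b, and each finite part
   of this oscillation already happens for one x_i, so b is an infinite branch. Cauchy sequences
   converge since the ultrapower is complete, and the limit is bounded by the uniform
   boundedness principle on X (use a principal ultrafilter to see that the means converge on X).

   The derivatives of a tree on a countable set are stationary from some stage below omega_1 on, so
   a well-founded tree has height below omega_1. The supremum over e is one over a sequence,
   as the trees decrease in e, and omega_1 has uncountable cofinality. *)
theory Submission
  imports Defs
begin

section \<open>Countable ordinals and heights of trees\<close>

lemma countable_lessThan_iff: "countable {..<\<alpha>} \<longleftrightarrow> \<alpha> < omega1"
proof
  show "countable {..<\<alpha>}" if "\<alpha> < omega1"
    using not_less_Least[of \<alpha> "\<lambda>\<alpha>. uncountable {..<\<alpha>}"] that by (auto simp: omega1_def)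
  show "\<alpha> < omega1" if "countable {..<\<alpha>}"
  proof (rule ccontr)
    assume "\<not> \<alpha> < omega1"
    then have "{..<omega1} \<subseteq> {..<\<alpha>}"
      by auto
    then show False
      using that uncountable_below_omega1 countable_subset by blast
  qed
qed

text \<open>Countably many countable initial segments have a countable union, so the uncountable set
  \<open>{..<omega1}\<close> has a point outside it, and this point lies above all of
  \<open>A\<close>. It bounds both the stages at which sequences leave a tree and the heights for
  countably many parameters.\<close>

lemma omega1_countable_cofinality:
  assumes "countable A" and "A \<subseteq> {..<omega1}"
  shows "\<exists>\<gamma><omega1. A \<subseteq> {..<\<gamma>}"
proof -
  have "countable {..\<alpha>}" if "\<alpha> \<in> A" for \<alpha>
    using assms(2) subsetD[OF _ that] countable_lessThan_iff[of \<alpha>]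
    by (auto simp add: ivl_disj_un_singleton(2)[symmetric] del: ivl_disj_un_singleton)
  then have "countable (\<Union>\<alpha>\<in>A. {..\<alpha>})"
    using assms(1) by blast
  then obtain \<gamma> where "\<gamma> < omega1" "\<gamma> \<notin> (\<Union>\<alpha>\<in>A. {..\<alpha>})"
    using uncountable_below_omega1 countable_subset by (metis lessThan_iff subsetI)
  then show ?thesis
    by (intro exI[of _ \<gamma>]) (auto simp: not_le)
qed

lemma ord_succ_less_omega1:
  assumes "\<alpha> < omega1"
  shows "ord_succ \<alpha> < omega1"
proof -
  obtain \<gamma> where "\<gamma> < omega1" "\<alpha> < \<gamma>"
    using omega1_countable_cofinality[of "{\<alpha>}"] assms by auto
  then show ?thesis
    using ord_succ_le_iff[of \<alpha> \<gamma>] by simp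
qed

lemma less_ord_succ_iff: "\<alpha> < ord_succ \<beta> \<longleftrightarrow> \<alpha> \<le> \<beta>"
  using ord_succ_le_iff[of \<beta> \<alpha>] by (metis not_le)

text \<open>The cases match the three clauses that define \<open>tree_deriv\<close>.\<close>

lemma ordinal_induct [case_names zero succ limit]:
  assumes "P bot" and "\<And>\<alpha>. P \<alpha> \<Longrightarrow> P (ord_succ \<alpha>)"
    and "\<And>\<alpha>. \<alpha> \<noteq> bot \<Longrightarrow> (\<And>\<beta>. \<alpha> \<noteq> ord_succ \<beta>) \<Longrightarrow> (\<And>\<beta>. \<beta> < \<alpha> \<Longrightarrow> P \<beta>) \<Longrightarrow> P \<alpha>"
  shows "P \<alpha>"
proof (induction \<alpha> rule: less_induct)
  case (less \<alpha>)
  then show ?case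
    using assms less_ord_succ by metis
qed

section \<open>Derivatives of trees\<close>

lemma tree_deriv_mono:
  assumes "\<S> \<subseteq> \<T>"
  shows "tree_deriv \<S> \<alpha> \<subseteq> tree_deriv \<T> \<alpha>"
proof (induction \<alpha> rule: ordinal_induct)
  case zero
  then show ?case using assms by (simp add: tree_deriv_zero)
next
  case (succ \<alpha>)
  then show ?case by (auto simp: tree_deriv_succ)
next
  case (limit \<alpha>)
  then show ?case using tree_deriv_limit[OF limit(1,2)] by fastforce
qed

text \<open>This is the defining property of a tree. The notions of derivative, height and
  well-foundedness are stated for arbitrary sets of lists, so it is carried as a hypothesis.\<close>

definition prefix_closed :: "'a list set \<Rightarrow> bool" where
  "prefix_closed \<T> \<longleftrightarrow> (\<forall>t\<in>\<T>. \<forall>s. prefix s t \<longrightarrow> s \<in> \<T>)"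

lemma prefix_closed_tree_deriv:
  assumes "prefix_closed \<T>"
  shows "prefix_closed (tree_deriv \<T> \<alpha>)"
proof (induction \<alpha> rule: ordinal_induct)
  case zero
  then show ?case using assms by (simp add: tree_deriv_zero)
next
  case (succ \<alpha>)
  then show ?case
    unfolding prefix_closed_def tree_deriv_succ
    by (blast intro: prefix_order.le_less_trans)
next
  case (limit \<alpha>)
  then show ?case
    using tree_deriv_limit[OF limit(1,2)] by (simp add: prefix_closed_def) blast
qed

text \<open>Closure under initial segments enters at successors: a sequence with a proper extension
  in a derivative lies in that derivative itself.\<close>

lemma tree_deriv_antimono:
  assumes "prefix_closed \<T>" and "\<alpha> \<le> \<beta>"
  shows "tree_deriv \<T> \<beta> \<subseteq> tree_deriv \<T> \<alpha>"
  using assms(2)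
proof (induction \<beta> rule: ordinal_induct)
  case zero
  then show ?case by (simp add: bot.extremum_unique)
next
  case (succ \<beta>)
  have "tree_deriv \<T> (ord_succ \<beta>) \<subseteq> tree_deriv \<T> \<beta>"
    using prefix_closed_tree_deriv[OF assms(1), of \<beta>]
    by (auto simp: prefix_closed_def tree_deriv_succ strict_prefix_def)
  then show ?case
    using succ less_ord_succ_iff[of \<alpha> \<beta>] by (cases "\<alpha> = ord_succ \<beta>") auto
next
  case (limit \<beta>)
  then show ?case
    using tree_deriv_limit[OF limit(1,2)] by (cases "\<alpha> = \<beta>") auto
qed

text \<open>Each initial segment of a branch is properly extended by the next one, so no derivative
  can remove any of them.\<close>

lemma branch_in_tree_deriv:
  assumes "\<And>n. map b [0..<n] \<in> \<T>"
  shows "map b [0..<n] \<in> tree_deriv \<T> \<alpha>"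
proof (induction \<alpha> arbitrary: n rule: ordinal_induct)
  case zero
  then show ?case using assms by (simp add: tree_deriv_zero)
next
  case (succ \<alpha>)
  have "strict_prefix (map b [0..<n]) (map b [0..<Suc n])"
    by (auto simp: strict_prefix_def)
  then show ?case
    using succ[of "Suc n"] unfolding tree_deriv_succ by blast
next
  case (limit \<alpha>)
  then show ?case
    using tree_deriv_limit[OF limit(1,2)] by simp
qed

lemma tree_deriv_ne_of_ill_founded:
  assumes "\<not> well_founded_tree \<T>"
  shows "tree_deriv \<T> \<alpha> \<noteq> {}"
proof -
  obtain b where "\<And>n. map b [0..<n] \<in> \<T>"
    using assms by (auto simp: well_founded_tree_def)
  then have "map b [0..<0] \<in> tree_deriv \<T> \<alpha>"
    by (rule branch_in_tree_deriv)
  then show ?thesis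
    by blast
qed

text \<open>Repeated choice of proper extensions inside \<open>\<S>\<close> gives a chain of
  sequences whose union is a branch. One extension may add several entries, so the segments of the
  branch are only initial segments of members of \<open>\<S>\<close>; they lie in
  \<open>\<T>\<close> by prefix closure.\<close>

lemma not_well_founded_of_pruned:
  assumes "prefix_closed \<T>" and "\<S> \<subseteq> \<T>" and "\<S> \<noteq> {}"
    and "\<And>s. s \<in> \<S> \<Longrightarrow> \<exists>t\<in>\<S>. strict_prefix s t"
  shows "\<not> well_founded_tree \<T>"
proof -
  obtain f where f: "\<And>n. f n \<in> \<S>" "\<And>n. strict_prefix (f n) (f (Suc n))"
    using dependent_nat_choice[of "\<lambda>_ s. s \<in> \<S>" "\<lambda>_. strict_prefix"] assms(3,4) by blast
  have mono: "prefix (f m) (f n)" if "m \<le> n" for m n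
    using that f(2) by (induction n rule: dec_induct) (auto simp: strict_prefix_def intro: prefix_order.trans)
  have len: "n \<le> length (f n)" for n
    using prefix_length_less[OF f(2)] by (induction n) (auto intro: Suc_leI le_less_trans)
  \<comment> \<open>By \<open>len\<close>, \<open>f (Suc n)\<close> is long enough to have an entry
    at position \<open>n\<close>, and by \<open>mono\<close> all later sequences of the chain share
    it.\<close>
  define b where "b n = f (Suc n) ! n" for n
  have "map b [0..<n] = take n (f n)" for n
  proof (rule nth_equalityI)
    show "length (map b [0..<n]) = length (take n (f n))"
      using len[of n] by simp
    fix i assume "i < length (map b [0..<n])"
    then have i: "i < n"
      by simp
    then obtain u where "f n = f (Suc i) @ u"
      using mono[of "Suc i" n] by (auto simp: prefix_def)
    then show "map b [0..<n] ! i = take n (f n) ! i"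
      using i len[of "Suc i"] by (simp add: b_def nth_append)
  qed
  then have "map b [0..<n] \<in> \<T>" for n
    using assms(1,2) f(1)[of n] take_is_prefix[of n "f n"] unfolding prefix_closed_def by auto
  then show ?thesis
    unfolding well_founded_tree_def by blast
qed

text \<open>There are only countably many finite sequences, so the stages at which they disappear
  have a bound \<open>\<gamma>\<close> below \<open>omega1\<close>. What is left at
  \<open>\<gamma>\<close> is never removed at a countable stage and is therefore pruned, which
  forces it to be empty.\<close>

lemma tree_deriv_empty_below_omega1:
  assumes "prefix_closed \<T>" and "well_founded_tree \<T>"
  obtains \<gamma> where "\<gamma> < omega1" and "tree_deriv \<T> \<gamma> = {}"
proof -
  \<comment> \<open>The stage is one at which \<open>s\<close> is already gone, if \<open>s\<close>
    disappears below \<open>omega1\<close> at all, and arbitrary otherwise.\<close>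
  have "\<exists>\<alpha><omega1. s \<in> tree_deriv \<T> \<alpha> \<longrightarrow> (\<forall>\<beta><omega1. s \<in> tree_deriv \<T> \<beta>)" for s
  proof (cases "\<forall>\<beta><omega1. s \<in> tree_deriv \<T> \<beta>")
    case True
    then show ?thesis
      using uncountable_below_omega1 by (metis countable_empty equals0I lessThan_iff)
  qed auto
  then obtain a where a: "\<And>s. a s < omega1"
      "\<And>s \<beta>. s \<in> tree_deriv \<T> (a s) \<Longrightarrow> \<beta> < omega1 \<Longrightarrow> s \<in> tree_deriv \<T> \<beta>"
    by metis
  obtain \<gamma> where \<gamma>: "\<gamma> < omega1" "\<And>s. a s < \<gamma>"
    using omega1_countable_cofinality[of "range a"] a(1) by (auto simp: image_subset_iff)
  \<comment> \<open>A sequence present at \<open>\<gamma>\<close> has outlived its stage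
    \<open>a s\<close>, so it is also present at the successor of \<open>\<gamma>\<close>.\<close>
  have "\<exists>t\<in>tree_deriv \<T> \<gamma>. strict_prefix s t" if "s \<in> tree_deriv \<T> \<gamma>" for s
  proof -
    have "s \<in> tree_deriv \<T> (a s)"
      using that tree_deriv_antimono[OF assms(1) less_imp_le[OF \<gamma>(2)]] by blast
    then have "s \<in> tree_deriv \<T> (ord_succ \<gamma>)"
      using a(2) ord_succ_less_omega1[OF \<gamma>(1)] by blast
    then show ?thesis
      by (simp add: tree_deriv_succ)
  qed
  moreover have "tree_deriv \<T> \<gamma> \<subseteq> \<T>"
    using tree_deriv_antimono[OF assms(1), of bot \<gamma>] by (simp add: tree_deriv_zero)
  ultimately have "tree_deriv \<T> \<gamma> = {}"
    using not_well_founded_of_pruned[OF assms(1)] assms(2) by blast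
  with \<gamma>(1) show thesis by (rule that)
qed

section \<open>Heights of trees\<close>

text \<open>An ill-founded tree has no empty derivative, so its height is the default value
  \<open>omega1\<close>; a well-founded one is exhausted at a countable stage.\<close>

lemma tree_height_less_omega1_iff:
  assumes "prefix_closed \<T>"
  shows "tree_height \<T> < omega1 \<longleftrightarrow> well_founded_tree \<T>"
proof
  assume "tree_height \<T> < omega1"
  then show "well_founded_tree \<T>"
    using tree_deriv_ne_of_ill_founded[of \<T>] by (auto simp: tree_height_def split: if_splits)
next
  assume "well_founded_tree \<T>"
  then obtain \<gamma> where \<gamma>: "\<gamma> < omega1" "tree_deriv \<T> \<gamma> = {}"
    using tree_deriv_empty_below_omega1[OF assms] by blast
  then have "(LEAST \<alpha>. tree_deriv \<T> \<alpha> = {}) \<le> \<gamma>"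
    by (simp add: Least_le)
  moreover have "tree_height \<T> = (LEAST \<alpha>. tree_deriv \<T> \<alpha> = {})"
    using \<gamma>(2) by (auto simp: tree_height_def)
  ultimately show "tree_height \<T> < omega1"
    using \<gamma>(1) by simp
qed

lemma tree_height_le_omega1:
  assumes "prefix_closed \<T>"
  shows "tree_height \<T> \<le> omega1"
proof (cases "well_founded_tree \<T>")
  case True
  then show ?thesis using tree_height_less_omega1_iff[OF assms] by simp
next
  case False
  then show ?thesis using tree_deriv_ne_of_ill_founded by (simp add: tree_height_def)
qed

text \<open>Well-foundedness of the larger tree ensures that its height is a stage with empty
  derivative and not the default value; the derivative of the smaller tree is empty there
  too.\<close>

lemma tree_height_mono:
  assumes "\<S> \<subseteq> \<T>" and "prefix_closed \<T>" and "well_founded_tree \<T>"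
  shows "tree_height \<S> \<le> tree_height \<T>"
proof -
  have ex: "\<exists>\<alpha>. tree_deriv \<T> \<alpha> = {}"
    using tree_deriv_empty_below_omega1[OF assms(2,3)] by blast
  then have "tree_deriv \<T> (tree_height \<T>) = {}"
    unfolding tree_height_def using LeastI_ex[OF ex] by simp
  then have "tree_deriv \<S> (tree_height \<T>) = {}"
    using tree_deriv_mono[OF assms(1)] by blast
  then show ?thesis
    using Least_le[of "\<lambda>\<alpha>. tree_deriv \<S> \<alpha> = {}" "tree_height \<T>"]
    by (auto simp: tree_height_def[of \<S>])
qed

section \<open>The trees of oscillations of Cesaro means\<close>

lemma prefix_closed_ergodic_tree: "prefix_closed (ergodic_tree T \<epsilon>)"
  unfolding prefix_closed_def
proof (intro ballI allI impI)
  fix t s assume t: "t \<in> ergodic_tree T \<epsilon>" and "prefix s t"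
  then obtain u where u: "t = s @ u"
    by (auto simp: prefix_def)
  show "s \<in> ergodic_tree T \<epsilon>"
  proof (cases "length t \<le> 1")
    case True
    with t u show ?thesis by (auto simp: ergodic_tree_def sorted_wrt_append)
  next
    case False
    with t obtain x where "x \<in> cball 0 1" and x: "\<And>p. Suc p < length t \<Longrightarrow>
        norm (cesaro T (t ! p) x - cesaro T (t ! Suc p) x) > \<epsilon>"
      by (auto simp: ergodic_tree_def)
    moreover have "norm (cesaro T (s ! p) x - cesaro T (s ! Suc p) x) > \<epsilon>"
      if "Suc p < length s" for p
      using x[of p] that by (simp add: u nth_append)
    moreover have "set s \<subseteq> {1..}" "sorted_wrt (<) s"
      using t u by (auto simp: ergodic_tree_def sorted_wrt_append)
    ultimately show ?thesis
      unfolding ergodic_tree_def by blast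
  qed
qed

lemma ergodic_tree_antimono:
  assumes "\<delta> \<le> \<epsilon>"
  shows "ergodic_tree T \<epsilon> \<subseteq> ergodic_tree T \<delta>"
  using le_less_trans[OF assms] unfolding ergodic_tree_def by blast

text \<open>The trees grow as \<open>\<epsilon>\<close> decreases, so the parameters
  \<open>1 / (n + 1)\<close> already determine the supremum, and countably many heights below
  \<open>omega1\<close> have a common bound below \<open>omega1\<close>.\<close>

lemma ergodic_height_less_omega1_iff:
  "ergodic_height T < omega1 \<longleftrightarrow> (\<forall>\<epsilon>>0. well_founded_tree (ergodic_tree T \<epsilon>))"
proof
  assume less: "ergodic_height T < omega1"
  \<comment> \<open>In a conditionally complete order, \<open>Sup\<close> is known to be an upper
    bound only for sets that are bounded above.\<close>
  have "bdd_above ((\<lambda>\<epsilon>. tree_height (ergodic_tree T \<epsilon>)) ` {0<..})"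
    using tree_height_le_omega1[OF prefix_closed_ergodic_tree] by (intro bdd_aboveI2)
  then have "tree_height (ergodic_tree T \<epsilon>) \<le> ergodic_height T" if "\<epsilon> > 0" for \<epsilon>
    unfolding ergodic_height_def using that by (intro cSUP_upper) auto
  with less show "\<forall>\<epsilon>>0. well_founded_tree (ergodic_tree T \<epsilon>)"
    using tree_height_less_omega1_iff[OF prefix_closed_ergodic_tree] le_less_trans by blast
next
  assume wf: "\<forall>\<epsilon>>0. well_founded_tree (ergodic_tree T \<epsilon>)"
  let ?h = "\<lambda>n. tree_height (ergodic_tree T (inverse (real (Suc n))))"
  have "?h n < omega1" for n
    using wf by (simp add: tree_height_less_omega1_iff[OF prefix_closed_ergodic_tree])
  then obtain \<gamma> where \<gamma>: "\<gamma> < omega1" "\<And>n. ?h n < \<gamma>"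
    using omega1_countable_cofinality[of "range ?h"] by (auto simp: image_subset_iff)
  have "tree_height (ergodic_tree T \<epsilon>) \<le> \<gamma>" if "\<epsilon> > 0" for \<epsilon>
  proof -
    obtain n where "inverse (real (Suc n)) < \<epsilon>"
      using reals_Archimedean \<open>\<epsilon> > 0\<close> by blast
    then have "tree_height (ergodic_tree T \<epsilon>) \<le> ?h n"
      using wf by (intro tree_height_mono ergodic_tree_antimono prefix_closed_ergodic_tree) auto
    then show ?thesis
      using \<gamma>(2)[of n] by simp
  qed
  then have "ergodic_height T \<le> \<gamma>"
    unfolding ergodic_height_def by (intro cSUP_least) auto
  with \<gamma>(1) show "ergodic_height T < omega1"
    by simp
qed

section \<open>Ultrafilters and uniform boundedness\<close>

text \<open>Smaller filters are finer and \<open>bot\<close> is the improper one, so Zorn's lemma is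
  used to find a minimal proper filter below \<open>F\<close>.\<close>

lemma ex_ultrafilter_le:
  assumes "F \<noteq> bot"
  obtains U where "ultrafilter U" and "U \<le> F"
proof -
  define A where "A = {G. G \<noteq> bot \<and> G \<le> F}"
  have po: "partial_order_on A (relation_of (\<ge>) A)"
    by (rule partial_order_on_relation_ofI) auto
  have "\<exists>G\<in>A. \<forall>H\<in>C. G \<le> H" if C: "C \<in> Chains (relation_of (\<ge>) A)" for C
  proof (cases "C = {}")
    case True
    then show ?thesis using assms by (auto simp: A_def)
  next
    case False
    have CA: "C \<subseteq> A" and total: "\<And>G H. G \<in> C \<Longrightarrow> H \<in> C \<Longrightarrow> G \<le> H \<or> H \<le> G"
      using C by (auto simp: Chains_def relation_of_def)
    \<comment> \<open>A chain is directed downwards, so its infimum gains no events beyond those of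
      its members and stays proper.\<close>
    have "eventually P (Inf C) \<longleftrightarrow> (\<exists>G\<in>C. eventually P G)" for P
    proof (rule eventually_Inf_base[OF False])
      fix G H assume "G \<in> C" "H \<in> C"
      with total[OF this] show "\<exists>x\<in>C. x \<le> inf G H"
        by auto
    qed
    then have "Inf C \<noteq> bot"
      using CA by (auto simp: A_def trivial_limit_def)
    moreover have "Inf C \<le> F"
      using False CA by (auto simp: A_def intro: Inf_lower2)
    ultimately show ?thesis
      by (auto simp: A_def intro: Inf_lower)
  qed
  then obtain U where U: "U \<in> A" and min: "\<And>G. G \<in> A \<Longrightarrow> G \<le> U \<Longrightarrow> G = U"
    using predicate_Zorn[OF po] by blast
  have "eventually P U \<or> eventually (\<lambda>i. \<not> P i) U" for P
  proof (rule disjCI)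
    assume "\<not> eventually (\<lambda>i. \<not> P i) U"
    \<comment> \<open>Adjoining the event \<open>P\<close> leaves the filter proper, so by
      minimality it changes nothing.\<close>
    then have "inf U (principal {i. P i}) \<noteq> bot"
      by (simp add: trivial_limit_def eventually_inf_principal)
    then have "inf U (principal {i. P i}) = U"
      using U by (intro min) (auto simp: A_def intro: le_infI1)
    then have "U \<le> principal {i. P i}"
      by (metis inf.cobounded2)
    then show "eventually P U"
      by (simp add: le_principal)
  qed
  then have "ultrafilter U"
    using U unfolding ultrafilter_def A_def by blast
  moreover have "U \<le> F"
    using U by (simp add: A_def)
  ultimately show thesis
    by (rule that)
qed

text \<open>This is the Banach-Steinhaus theorem by Baire category: the closed sets
  \<open>S n\<close> cover the space, so one of them contains a ball.\<close>

lemma uniform_boundedness: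
  fixes f :: "'i \<Rightarrow> 'a :: {real_normed_vector, complete_space} \<Rightarrow> 'b :: real_normed_vector"
  assumes lin: "\<And>i. bounded_linear (f i)"
    and ptw: "\<And>x. \<exists>C. \<forall>i. norm (f i x) \<le> C"
  obtains K where "K > 0" and "\<And>i x. norm (f i x) \<le> K * norm x"
proof -
  define S where "S n = {x. \<forall>i. norm (f i x) \<le> real n}" for n :: nat
  have S_eq: "S n = (\<Inter>i. {x. norm (f i x) \<le> real n})" for n
    by (auto simp: S_def)
  have cl: "closed (S n)" for n
    unfolding S_eq by (intro closed_INT ballI closed_Collect_le continuous_intros
        bounded_linear.continuous_on[OF lin])
  have "\<exists>n. x \<in> S n" for x
  proof -
    obtain C where C: "\<And>i. norm (f i x) \<le> C"
      using ptw[of x] by blast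
    obtain n :: nat where "C \<le> real n"
      using real_arch_simple by blast
    with C have "x \<in> S n"
      unfolding S_def using order_trans by blast
    then show ?thesis ..
  qed
  then have "\<Union>(range S) = UNIV"
    by blast
  moreover have "Met_TC.mcomplete TYPE('a)"
    by (simp add: complete_UNIV)
  ultimately obtain n where "interior (S n) \<noteq> {}"
    using Met_TC.metric_Baire_category_alt[of "range S"] cl by fastforce
  then obtain x0 e where "e > 0" and ball: "cball x0 e \<subseteq> S n"
    by (metis all_not_in_conv mem_interior_cball)
  have bound: "norm (f i x) \<le> (2 * real n / e) * norm x" for i x
  proof (cases "x = 0")
    case True
    then show ?thesis by (simp add: linear_0[OF bounded_linear.linear[OF lin]])
  next
    case False
    interpret fi: bounded_linear "f i" by (rule lin)
    \<comment> \<open>The vector \<open>x\<close> is rescaled to the radius of the ball; the value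
      at \<open>?y\<close> is then a difference of values at two points of the ball.\<close>
    let ?y = "(e / norm x) *\<^sub>R x"
    have "x0 + ?y \<in> S n" "x0 \<in> S n"
      using ball \<open>e > 0\<close> False by (auto simp: subset_iff dist_norm)
    then have "norm (f i (x0 + ?y)) \<le> n" "norm (f i x0) \<le> n"
      by (auto simp: S_def)
    moreover have "norm (f i ?y) = norm (f i (x0 + ?y) - f i x0)"
      by (simp add: fi.add)
    ultimately have "norm (f i ?y) \<le> 2 * real n"
      using norm_triangle_ineq4[of "f i (x0 + ?y)" "f i x0"] by linarith
    then show ?thesis
      using \<open>e > 0\<close> False by (simp add: fi.scaleR field_simps)
  qed
  show thesis
  \<comment> \<open>The summand 1 keeps the constant positive when \<open>n = 0\<close>.\<close>
  proof (rule that[of "2 * real n / e + 1"])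
    show "2 * real n / e + 1 > 0"
      using \<open>e > 0\<close> by (simp add: add_nonneg_pos)
    show "norm (f i x) \<le> (2 * real n / e + 1) * norm x" for i x
      using bound[of i x] by (simp add: distrib_right add_increasing2)
  qed
qed

section \<open>Ergodicity on a quotient space\<close>

lemma infdist_greatest:
  assumes "M \<noteq> {}" and "\<And>m. m \<in> M \<Longrightarrow> c \<le> dist x m"
  shows "c \<le> infdist x M"
  using assms by (auto simp: infdist_notempty intro: cINF_greatest)

lemma infdist_lessE:
  assumes "M \<noteq> {}" and "infdist x M < c"
  obtains m where "m \<in> M" and "dist x m < c"
  using assms infdist_greatest[of M c x] by (meson not_le)

text \<open>For \<open>m\<close> in \<open>M\<close>, the point \<open>S m\<close> is again in
  \<open>M\<close> and competes for the distance of \<open>S x\<close>. The infimum over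
  \<open>m\<close> is taken after division by \<open>K\<close>, so \<open>K = 0\<close> is treated
  apart.\<close>

lemma infdist_linear_le:
  assumes M: "subspace M" and "linear S" "S ` M \<subseteq> M"
    and "K \<ge> 0" and K: "\<And>x. norm (S x) \<le> K * norm x"
  shows "infdist (S x) M \<le> K * infdist x M"
proof (cases "K = 0")
  case True
  then have "S x = 0"
    using K[of x] by simp
  with True show ?thesis
    using subspace_0[OF M] by simp
next
  case False
  have "infdist (S x) M / K \<le> infdist x M"
  proof (rule infdist_greatest)
    fix m assume "m \<in> M"
    then have "infdist (S x) M \<le> dist (S x) (S m)"
      using assms(3) by (intro infdist_le) auto
    also have "\<dots> \<le> K * dist x m"
      using K[of "x - m"] by (simp add: dist_norm linear_diff[OF assms(2)])
    finally show "infdist (S x) M / K \<le> dist x m"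
      using False \<open>K \<ge> 0\<close> by (simp add: field_simps)
  qed (use subspace_0[OF M] in auto)
  then show ?thesis
    using False \<open>K \<ge> 0\<close> by (simp add: field_simps)
qed

lemma infdist_scaleR_le:
  fixes M :: "'v :: real_normed_vector set"
  assumes "subspace M"
  shows "infdist (c *\<^sub>R x) M \<le> \<bar>c\<bar> * infdist x M"
  by (rule infdist_linear_le[OF assms linear_scale_self]) (auto intro: subspace_scale[OF assms])

lemma infdist_diff_commute:
  fixes M :: "'v :: real_normed_vector set"
  assumes "subspace M"
  shows "infdist (x - y) M = infdist (y - x) M"
  using infdist_scaleR_le[OF assms, of "-1" "x - y"] infdist_scaleR_le[OF assms, of "-1" "y - x"]
  by simp

lemma infdist_add_le:
  fixes M :: "'v :: real_normed_vector set"
  assumes M: "subspace M"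
  shows "infdist (x + y) M \<le> infdist x M + infdist y M"
proof -
  have ne: "M \<noteq> {}"
    using subspace_0[OF M] by auto
  have "infdist (x + y) M - infdist y M \<le> dist x m" if m: "m \<in> M" for m
  proof -
    have "infdist (x + y) M - dist x m \<le> dist y m'" if "m' \<in> M" for m'
    proof -
      have "infdist (x + y) M \<le> dist (x + y) (m + m')"
        using m that by (intro infdist_le subspace_add[OF M])
      also have "\<dots> \<le> dist x m + dist y m'"
        using norm_triangle_ineq[of "x - m" "y - m'"] by (simp add: dist_norm algebra_simps)
      finally show ?thesis by simp
    qed
    then have "infdist (x + y) M - dist x m \<le> infdist y M"
      by (rule infdist_greatest[OF ne])
    then show ?thesis by simp
  qed
  then have "infdist (x + y) M - infdist y M \<le> infdist x M"
    by (rule infdist_greatest[OF ne])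
  then show ?thesis by simp
qed

lemma infdist_diff_triangle:
  fixes M :: "'v :: real_normed_vector set"
  assumes "subspace M"
  shows "infdist (x - z) M \<le> infdist (x - y) M + infdist (y - z) M"
  using infdist_add_le[OF assms, of "x - y" "y - z"] by simp

section \<open>Completeness of the quotient\<close>

text \<open>Between two indices \<open>u\<close> moves at most as far as the partial sums of
  \<open>c\<close>, which converge.\<close>

lemma Cauchy_of_summable_dist:
  fixes u :: "nat \<Rightarrow> 'v :: metric_space"
  assumes "summable c" and le: "\<And>k. dist (u k) (u (Suc k)) \<le> c k"
  shows "Cauchy u"
proof -
  let ?s = "\<lambda>n. \<Sum>k<n. c k"
  have s: "dist (u m) (u n) \<le> dist (?s m) (?s n)" if "m \<le> n" for m n
  proof -
    have "dist (u m) (u n) \<le> ?s n - ?s m"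
      using that
    proof (induction n rule: dec_induct)
      case (step n)
      then show ?case
        using le[of n] dist_triangle[of "u m" "u (Suc n)" "u n"] by simp
    qed simp
    then show ?thesis
      by (simp add: dist_real_def)
  qed
  have "Cauchy ?s"
    using assms(1) by (simp add: summable_iff_convergent convergent_Cauchy)
  show ?thesis
  proof (rule metric_CauchyI)
    fix e :: real assume "e > 0"
    with \<open>Cauchy ?s\<close> obtain N where N: "\<And>m n. m \<ge> N \<Longrightarrow> n \<ge> N \<Longrightarrow> dist (?s m) (?s n) < e"
      by (metis metric_CauchyD)
    have "dist (u m) (u n) < e" if "m \<ge> N" "n \<ge> N" for m n
      using s[of m n] s[of n m] N[OF that] by (cases "m \<le> n") (auto simp: dist_commute)
    then show "\<exists>N. \<forall>m\<ge>N. \<forall>n\<ge>N. dist (u m) (u n) < e"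
      by blast
  qed
qed

text \<open>A rapidly converging subsequence is corrected by elements of \<open>M\<close> until it
  is Cauchy in the whole space. Its limit there represents the limit in the quotient, and a Cauchy
  sequence converges as soon as a subsequence does.\<close>

lemma quotient_complete:
  fixes v :: "nat \<Rightarrow> 'v :: real_normed_vector"
  assumes M: "subspace M" and complete: "complete (UNIV :: 'v set)"
    and cauchy: "\<And>e. e > 0 \<Longrightarrow> \<exists>N. \<forall>m\<ge>N. \<forall>n\<ge>N. infdist (v m - v n) M < e"
  shows "\<exists>w. (\<lambda>n. infdist (v n - w) M) \<longlonglongrightarrow> 0"
proof -
  have ne: "M \<noteq> {}"
    using subspace_0[OF M] by auto
  have "\<exists>N. \<forall>m\<ge>N. \<forall>n\<ge>N. infdist (v m - v n) M < (1/2) ^ k" for k :: nat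
    by (rule cauchy) simp
  then obtain N where N: "\<And>k m n. m \<ge> N k \<Longrightarrow> n \<ge> N k \<Longrightarrow> infdist (v m - v n) M < (1/2) ^ k"
    by metis
  \<comment> \<open>Partial sums give a nondecreasing choice of indices that dominates
    \<open>N\<close>.\<close>
  define r where "r k = (\<Sum>j\<le>k. N j)" for k
  have r_Suc: "r (Suc k) \<ge> r k" and r_N: "r k \<ge> N k" for k
    by (cases k; simp add: r_def)+
  have "\<exists>m\<in>M. dist (v (r (Suc k)) - v (r k)) m < (1/2) ^ k" for k
  proof -
    have "infdist (v (r (Suc k)) - v (r k)) M < (1/2) ^ k"
      using r_N[of k] r_Suc[of k] by (intro N) auto
    then show ?thesis
      by (rule infdist_lessE[OF ne]) blast
  qed
  then obtain m where m: "\<And>k. m k \<in> M"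
      "\<And>k. dist (v (r (Suc k)) - v (r k)) (m k) < (1/2) ^ k"
    by metis
  \<comment> \<open>\<open>u k\<close> represents the same coset as \<open>v (r k)\<close>; the
    correction \<open>m k\<close> makes the increment from \<open>u k\<close> to
    \<open>u (Suc k)\<close> smaller than \<open>(1/2) ^ k\<close>.\<close>
  define u where "u k = v (r k) - (\<Sum>j<k. m j)" for k
  have "Cauchy u"
  proof (rule Cauchy_of_summable_dist)
    show "summable (\<lambda>k. (1/2) ^ k :: real)"
      by (simp add: summable_geometric)
    show "dist (u k) (u (Suc k)) \<le> (1/2) ^ k" for k
      using less_imp_le[OF m(2)[of k]]
      by (simp add: u_def dist_norm norm_minus_commute algebra_simps)
  qed
  then obtain w where w: "u \<longlonglongrightarrow> w"
    using complete by (auto simp: complete_def)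
  have "(\<lambda>n. infdist (v n - w) M) \<longlonglongrightarrow> 0"
  proof (rule LIMSEQ_I)
    fix e :: real assume "e > 0"
    have "\<forall>\<^sub>F k in sequentially. (1/2) ^ k < e / 2"
      using \<open>e > 0\<close> by (intro order_tendstoD(2)[OF LIMSEQ_power_zero]) auto
    moreover have "\<forall>\<^sub>F k in sequentially. dist (u k) w < e / 2"
      using \<open>e > 0\<close> by (intro tendstoD[OF w]) simp
    ultimately obtain k where k: "(1/2) ^ k < e / 2" "dist (u k) w < e / 2"
      using eventually_happens[OF eventually_conj] by force
    have "infdist (v (r k) - w) M \<le> dist (u k) w"
    proof (rule infdist_le2)
      show "(\<Sum>j<k. m j) \<in> M"
        using m(1) by (intro subspace_sum[OF M])
      show "dist (v (r k) - w) (\<Sum>j<k. m j) \<le> dist (u k) w"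
        by (simp add: u_def dist_norm algebra_simps)
    qed
    then have "infdist (v n - w) M < e" if "n \<ge> r k" for n
      using infdist_diff_triangle[OF M, of "v n" w "v (r k)"] N[of k n "r k"] r_N[of k] that k
      by simp
    then show "\<exists>n0. \<forall>n\<ge>n0. norm (infdist (v n - w) M - 0) < e"
      by (intro exI[of _ "r k"]) (simp add: infdist_nonneg)
  qed
  then show ?thesis ..
qed

section \<open>Ergodicity of a quotient map in terms of representatives\<close>

lemma carrier_quotient_nspace: "nsp_carrier (quotient_nspace M) = range (qcoset M)"
  by (simp add: quotient_nspace_def)

text \<open>Since \<open>M = - M\<close>, the norms of the elements of a coset are the distances
  from \<open>x\<close> to the points of \<open>M\<close>.\<close>

lemma norm_quotient_nspace:
  assumes "subspace M"
  shows "nsp_norm (quotient_nspace M) (qcoset M x) = infdist x M"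
proof -
  have "norm ` qcoset M x = dist x ` M"
  proof (intro equalityI subsetI)
    fix c assume "c \<in> norm ` qcoset M x"
    then obtain m where "m \<in> M" "c = dist x (- m)"
      by (auto simp: qcoset_def dist_norm)
    then show "c \<in> dist x ` M"
      using subspace_neg[OF assms] by blast
  next
    fix c assume "c \<in> dist x ` M"
    then obtain m where "m \<in> M" "c = norm (x + (- m))"
      by (auto simp: dist_norm)
    then show "c \<in> norm ` qcoset M x"
      unfolding qcoset_def using subspace_neg[OF assms] by blast
  qed
  moreover have "M \<noteq> {}"
    using subspace_0[OF assms] by auto
  ultimately show ?thesis
    by (simp add: quotient_nspace_def infdist_notempty)
qed

lemma diff_quotient_nspace:
  assumes "subspace M"
  shows "nsp_diff (quotient_nspace M) (qcoset M x) (qcoset M y) = qcoset M (x - y)"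
  by (simp add: nsp_diff_def quotient_scale_qcoset[OF assms] quotient_add_qcoset[OF assms])

lemma cesaro_quotient_nspace:
  assumes M: "subspace M" and S: "linear S" "S ` M \<subseteq> M"
  shows "nsp_cesaro (quotient_nspace M) (quotient_map M S) n (qcoset M x) = qcoset M (cesaro S n x)"
proof -
  have "(quotient_map M S ^^ k) (qcoset M x) = qcoset M ((S ^^ k) x)" for k
    by (induction k) (simp_all add: quotient_map_qcoset[OF M S])
  moreover have "nsp_sum (quotient_nspace M) (\<lambda>k. qcoset M (f k)) n = qcoset M (\<Sum>k<n. f k)" for f
    by (induction n) (simp_all add: quotient_add_qcoset[OF M], simp add: quotient_nspace_def)
  ultimately show ?thesis
    by (simp add: nsp_cesaro_def cesaro_def quotient_scale_qcoset[OF M])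
qed

lemma linear_funpow:
  fixes S :: "'v :: real_vector \<Rightarrow> 'v"
  assumes "linear S"
  shows "linear (S ^^ k)"
  using assms by (induction k) (auto intro!: linearI simp: linear_add linear_scale)

lemma linear_cesaro:
  assumes "linear S"
  shows "linear (cesaro S n)"
  unfolding cesaro_def[abs_def]
  by (intro linear_compose_scale_right linear_compose_sum ballI linear_funpow assms)

lemma cesaro_image_subset:
  assumes "subspace M" and "S ` M \<subseteq> M"
  shows "cesaro S n ` M \<subseteq> M"
proof -
  have "(S ^^ k) x \<in> M" if "x \<in> M" for k x
    using that assms(2) by (induction k) auto
  then show ?thesis
    by (auto simp: cesaro_def intro!: subspace_scale[OF assms(1)] subspace_sum[OF assms(1)])
qed

lemma nsp_ergodic_quotientD:
  assumes M: "subspace M" and S: "linear S" "S ` M \<subseteq> M"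
    and "nsp_ergodic (quotient_nspace M) (quotient_map M S)"
  shows "\<exists>w. (\<lambda>n. infdist (cesaro S n x - w) M) \<longlonglongrightarrow> 0"
proof -
  obtain P where "nsp_bounded_linear (quotient_nspace M) P" and
    P: "\<And>x. (\<lambda>n. nsp_norm (quotient_nspace M) (nsp_diff (quotient_nspace M)
        (qcoset M (cesaro S n x)) (P (qcoset M x)))) \<longlonglongrightarrow> 0"
    using assms(4) unfolding nsp_ergodic_def carrier_quotient_nspace
    by (auto simp: cesaro_quotient_nspace[OF M S])
  then obtain w where "P (qcoset M x) = qcoset M w"
    by (auto simp: nsp_bounded_linear_def carrier_quotient_nspace Pi_iff dest: spec[of _ x])
  then show ?thesis
    using P[of x] by (auto simp: diff_quotient_nspace[OF M] norm_quotient_nspace[OF M])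
qed

text \<open>Completeness gives a limit for each coset, the bound \<open>K\<close> on the means
  passes to the limit operator, and closedness of \<open>M\<close> turns distance zero into equality
  of cosets.\<close>

lemma nsp_ergodic_quotientI:
  fixes S :: "'v :: real_normed_vector \<Rightarrow> 'v"
  assumes complete: "complete (UNIV :: 'v set)"
    and M: "subspace M" "closed M" and S: "linear S" "S ` M \<subseteq> M"
    and "K \<ge> 0" and K: "\<And>n x. norm (cesaro S n x) \<le> K * norm x"
    and cauchy: "\<And>x e. e > 0 \<Longrightarrow>
      \<exists>N. \<forall>m\<ge>N. \<forall>n\<ge>N. infdist (cesaro S m x - cesaro S n x) M < e"
  shows "nsp_ergodic (quotient_nspace M) (quotient_map M S)"
proof -
  \<comment> \<open>Convergence is kept as a relation between representatives, because limits are
    unique only modulo \<open>M\<close>.\<close>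
  define L where "L x w \<longleftrightarrow> (\<lambda>n. infdist (cesaro S n x - w) M) \<longlonglongrightarrow> 0" for x w
  note linear_A = linear_cesaro[OF S(1)]
  have L_add: "L (x + y) (w + z)" if "L x w" "L y z" for x y w z
    unfolding L_def
  proof (rule tendsto_sandwich[OF _ _ tendsto_const])
    show "(\<lambda>n. infdist (cesaro S n x - w) M + infdist (cesaro S n y - z) M) \<longlonglongrightarrow> 0"
      using that tendsto_add unfolding L_def by fastforce
    show "\<forall>\<^sub>F n in sequentially. infdist (cesaro S n (x + y) - (w + z)) M
        \<le> infdist (cesaro S n x - w) M + infdist (cesaro S n y - z) M"
      using infdist_add_le[OF M(1), of "cesaro S _ x - w" "cesaro S _ y - z"]
      by (simp add: linear_add[OF linear_A] algebra_simps)
  qed (simp add: infdist_nonneg)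
  have L_scale: "L (c *\<^sub>R x) (c *\<^sub>R w)" if "L x w" for c x w
    unfolding L_def
  proof (rule tendsto_sandwich[OF _ _ tendsto_const])
    show "(\<lambda>n. \<bar>c\<bar> * infdist (cesaro S n x - w) M) \<longlonglongrightarrow> 0"
      using that tendsto_mult_right_zero unfolding L_def by blast
    show "\<forall>\<^sub>F n in sequentially. infdist (cesaro S n (c *\<^sub>R x) - c *\<^sub>R w) M
        \<le> \<bar>c\<bar> * infdist (cesaro S n x - w) M"
      using infdist_scaleR_le[OF M(1), of c "cesaro S _ x - w"]
      by (simp add: linear_scale[OF linear_A] algebra_simps)
  qed (simp add: infdist_nonneg)
  have L_bound: "infdist w M \<le> K * infdist x M" if "L x w" for x w
  proof (rule tendsto_lowerbound)
    show "(\<lambda>n. infdist (cesaro S n x - w) M + K * infdist x M) \<longlonglongrightarrow> K * infdist x M"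
      using that tendsto_add[OF _ tendsto_const] unfolding L_def by fastforce
    have "infdist w M \<le> infdist (cesaro S n x - w) M + K * infdist x M" for n
      using infdist_diff_triangle[OF M(1), of w 0 "cesaro S n x"]
        infdist_diff_commute[OF M(1), of w "cesaro S n x"]
        infdist_linear_le[OF M(1) linear_A cesaro_image_subset[OF M(1) S(2)] \<open>K \<ge> 0\<close> K, of n x]
      by simp
    then show "\<forall>\<^sub>F n in sequentially.
        infdist w M \<le> infdist (cesaro S n x - w) M + K * infdist x M"
      by simp
  qed simp
  \<comment> \<open>The bound for the limit of \<open>x - y\<close>, whose distance to
    \<open>M\<close> is zero, gives uniqueness of the limit coset and independence of the
    representative at once.\<close>
  have L_unique: "qcoset M w = qcoset M z" if "L x w" "L y z" "qcoset M x = qcoset M y" for x y w z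
  proof -
    have "x - y \<in> M"
      using that(3) by (simp add: qcoset_eq_iff[OF M(1)])
    moreover have "L (x - y) (w - z)"
      using L_add[OF that(1) L_scale[OF that(2), of "-1"]] by simp
    ultimately have "infdist (w - z) M \<le> 0"
      using L_bound by fastforce
    then have "w - z \<in> M"
      using in_closed_iff_infdist_zero[OF M(2)] subspace_0[OF M(1)]
        infdist_nonneg[of "w - z" M] by fastforce
    then show ?thesis
      by (simp add: qcoset_eq_iff[OF M(1)])
  qed
  have "\<exists>w. L x w" for x
    unfolding L_def by (rule quotient_complete[OF M(1) complete cauchy])
  then obtain l where l: "\<And>x. L x (l x)"
    by metis
  define P where "P \<xi> = qcoset M (l (SOME x. \<xi> = qcoset M x))" for \<xi>
  have P: "P (qcoset M x) = qcoset M w" if "L x w" for x w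
  proof -
    have "qcoset M x = qcoset M (SOME y. qcoset M x = qcoset M y)"
      by (rule someI) simp
    then show ?thesis
      unfolding P_def using L_unique[OF l that] by simp
  qed
  have "nsp_bounded_linear (quotient_nspace M) P"
    unfolding nsp_bounded_linear_def carrier_quotient_nspace
  proof (intro conjI ballI allI exI[of _ K])
    show "P \<in> range (qcoset M) \<rightarrow> range (qcoset M)"
      by (auto simp: P_def)
    fix \<xi> assume "\<xi> \<in> range (qcoset M)"
    then obtain x where x: "\<xi> = qcoset M x"
      by auto
    show "nsp_norm (quotient_nspace M) (P \<xi>) \<le> K * nsp_norm (quotient_nspace M) \<xi>"
      using L_bound[OF l[of x]] by (simp add: x P[OF l] norm_quotient_nspace[OF M(1)])
    show "P (nsp_scale (quotient_nspace M) c \<xi>) = nsp_scale (quotient_nspace M) c (P \<xi>)" for c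
      by (simp add: x P[OF l, of x] P[OF L_scale[OF l, of c x]] quotient_scale_qcoset[OF M(1)])
    fix \<eta> assume "\<eta> \<in> range (qcoset M)"
    then obtain y where y: "\<eta> = qcoset M y"
      by auto
    show "P (nsp_add (quotient_nspace M) \<xi> \<eta>) = nsp_add (quotient_nspace M) (P \<xi>) (P \<eta>)"
      by (simp add: x y P[OF l, of x] P[OF l, of y] P[OF L_add[OF l l, of x y]] quotient_add_qcoset[OF M(1)])
  qed
  moreover have "(\<lambda>n. nsp_norm (quotient_nspace M) (nsp_diff (quotient_nspace M)
      (nsp_cesaro (quotient_nspace M) (quotient_map M S) n \<xi>) (P \<xi>))) \<longlonglongrightarrow> 0"
    if \<xi>: "\<xi> \<in> nsp_carrier (quotient_nspace M)" for \<xi>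
  proof -
    obtain x where x: "\<xi> = qcoset M x"
      using \<xi> by (auto simp: carrier_quotient_nspace)
    show ?thesis
      using l[of x] unfolding L_def
      by (simp add: x P[OF l] cesaro_quotient_nspace[OF M(1) S] diff_quotient_nspace[OF M(1)]
          norm_quotient_nspace[OF M(1)])
  qed
  ultimately show ?thesis
    unfolding nsp_ergodic_def by blast
qed

section \<open>Ultrapowers\<close>

text \<open>
  The library provides \<open>complete_space\<close> for \<open>\<Rightarrow>\<^sub>C\<close> only when the domain is a metric space, and \<open>nat\<close> has
  no \<open>metric_space\<close> instance.
\<close>

lemma complete_UNIV_bcontfun:
  "complete (UNIV :: ('a :: topological_space \<Rightarrow>\<^sub>C 'b :: complete_space) set)"
proof (rule completeI)
  fix f :: "nat \<Rightarrow> 'a \<Rightarrow>\<^sub>C 'b" assume "Cauchy f"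
  have "dist (apply_bcontfun (f m) x) (apply_bcontfun (f n) x) \<le> dist (f m) (f n)" for m n x
    by (rule dist_bounded)
  then have "\<forall>e>0. \<exists>N. \<forall>m n x. N \<le> m \<and> N \<le> n \<and> True \<longrightarrow>
      dist (apply_bcontfun (f m) x) (apply_bcontfun (f n) x) < e"
    using \<open>Cauchy f\<close> unfolding Cauchy_def by (meson le_less_trans)
  then obtain g where "uniform_limit UNIV (\<lambda>n. apply_bcontfun (f n)) g sequentially"
    using uniformly_convergent_eq_cauchy[of "\<lambda>_. True" "\<lambda>n. apply_bcontfun (f n)"]
    unfolding uniform_limit_sequentially_iff by auto
  then show "\<exists>l\<in>UNIV. f \<longlonglongrightarrow> l"
    by (rule uniform_limit_bcontfunE) auto
qed

section \<open>The quotient norm of an ultrapower\<close>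

text \<open>The approximating null sequence agrees with \<open>x\<close> where the norm exceeds
  \<open>e\<close> and is 0 elsewhere; it vanishes eventually along \<open>U\<close>.\<close>

lemma infdist_null_sequences_le:
  assumes "\<forall>\<^sub>F i in U. norm (apply_bcontfun x i) \<le> e" and "e \<ge> 0"
  shows "infdist x (null_sequences U) \<le> e"
proof -
  define f where "f i = (if norm (apply_bcontfun x i) \<le> e then 0 else apply_bcontfun x i)" for i
  have "f \<in> bcontfun"
    unfolding bcontfun_def
    by (auto simp: f_def continuous_on_discrete intro!: boundedI[of _ "norm x"] norm_bounded)
  then obtain m where m: "apply_bcontfun m = f"
    by (metis Bcontfun_inverse)
  have "((\<lambda>i. norm (apply_bcontfun m i)) \<longlongrightarrow> 0) U"
    by (rule tendsto_eventually) (use assms(1) in \<open>auto simp: m f_def elim: eventually_mono\<close>)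
  then have "m \<in> null_sequences U"
    by (simp add: null_sequences_def)
  moreover have "dist x m \<le> e"
    using \<open>e \<ge> 0\<close> by (intro dist_bound) (simp add: m f_def dist_norm)
  ultimately show ?thesis
    by (rule infdist_le2)
qed

text \<open>For a null sequence \<open>m\<close>, the norm of \<open>x\<close> at \<open>i\<close>
  is at most \<open>dist x m\<close> plus the norm of \<open>m\<close> at \<open>i\<close>, and the
  last term tends to 0 along the proper filter \<open>U\<close>.\<close>

lemma infdist_null_sequences_ge:
  fixes x :: "nat \<Rightarrow>\<^sub>C 'a :: real_normed_vector"
  assumes "U \<noteq> bot" and "\<forall>\<^sub>F i in U. e \<le> norm (apply_bcontfun x i)"
  shows "e \<le> infdist x (null_sequences U)"
proof (rule infdist_greatest)
  show "null_sequences U \<noteq> {}"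
    using subspace_0[OF subspace_null_sequences] by blast
  fix m :: "nat \<Rightarrow>\<^sub>C 'a" assume "m \<in> null_sequences U"
  then have "((\<lambda>i. dist x m + norm (apply_bcontfun m i)) \<longlongrightarrow> dist x m + 0) U"
    unfolding null_sequences_def by (intro tendsto_add) auto
  then have "((\<lambda>i. dist x m + norm (apply_bcontfun m i)) \<longlongrightarrow> dist x m) U"
    by simp
  then show "e \<le> dist x m"
  proof (rule tendsto_lowerbound)
    have le: "norm (apply_bcontfun x i) \<le> dist x m + norm (apply_bcontfun m i)" for i
      using dist_bounded[of x i m] norm_triangle_sub[of "apply_bcontfun x i" "apply_bcontfun m i"]
      by (simp add: dist_norm)
    show "\<forall>\<^sub>F i in U. e \<le> dist x m + norm (apply_bcontfun m i)"
      using assms(2) by (rule eventually_mono) (rule order_trans[OF _ le])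
  qed (rule assms(1))
qed

lemma closed_null_sequences: "closed (null_sequences U)"
proof -
  have "x \<in> null_sequences U" if x: "x \<in> closure (null_sequences U)" for x
  proof -
    have "((\<lambda>i. norm (apply_bcontfun x i)) \<longlongrightarrow> 0) U"
    proof (rule tendstoI)
      fix e :: real assume "e > 0"
      then obtain m where m: "m \<in> null_sequences U" "dist m x < e / 2"
        using x by (metis closure_approachable half_gt_zero)
      then have "\<forall>\<^sub>F i in U. dist (norm (apply_bcontfun m i)) 0 < e / 2"
        unfolding null_sequences_def using \<open>e > 0\<close> by (intro tendstoD) auto
      then show "\<forall>\<^sub>F i in U. dist (norm (apply_bcontfun x i)) 0 < e"
      proof (rule eventually_mono)
        fix i assume "dist (norm (apply_bcontfun m i)) 0 < e / 2"
        then show "dist (norm (apply_bcontfun x i)) 0 < e"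
          using m(2) dist_bounded[of m i x]
            norm_triangle_sub[of "apply_bcontfun x i" "apply_bcontfun m i"]
          by (simp add: dist_norm norm_minus_commute)
      qed
    qed
    then show ?thesis
      by (simp add: null_sequences_def)
  qed
  then show ?thesis
    by (metis closure_subset closure_eq subsetI subset_antisym)
qed

lemma linear_sequence_map:
  assumes "bounded_linear T"
  shows "linear (sequence_map T)"
proof -
  interpret T: bounded_linear T by fact
  show ?thesis
    by (rule linearI) (auto intro!: bcontfun_eqI simp: apply_sequence_map[OF assms] T.add T.scale)
qed

lemma sequence_map_null_sequences:
  assumes "bounded_linear T"
  shows "sequence_map T ` null_sequences U \<subseteq> null_sequences U"
  using bounded_linear.tendsto_zero[OF assms]
  by (auto simp: null_sequences_def apply_sequence_map[OF assms] tendsto_norm_zero_iff)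

lemma apply_bcontfun_sum:
  "apply_bcontfun (\<Sum>k<n. f k) i = (\<Sum>k<(n::nat). apply_bcontfun (f k) i)"
  by (induction n) simp_all

lemma apply_cesaro_sequence_map:
  assumes "bounded_linear T"
  shows "apply_bcontfun (cesaro (sequence_map T) n x) i = cesaro T n (apply_bcontfun x i)"
proof -
  have "apply_bcontfun ((sequence_map T ^^ k) x) i = (T ^^ k) (apply_bcontfun x i)" for k
    by (induction k) (simp_all add: apply_sequence_map[OF assms])
  then show ?thesis
    by (simp add: cesaro_def apply_bcontfun_sum)
qed

lemma bounded_linear_cesaro:
  fixes T :: "'a :: real_normed_vector \<Rightarrow> 'a"
  assumes "bounded_linear T"
  shows "bounded_linear (cesaro T n)"
proof -
  have "bounded_linear (\<lambda>x. (T ^^ k) x)" for k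
    by (induction k) (simp_all add: bounded_linear_compose[OF assms])
  then show ?thesis
    unfolding cesaro_def[abs_def]
    by (intro bounded_linear_compose[OF bounded_linear_scaleR_right] bounded_linear_sum)
qed

section \<open>Branches of the trees and super-ergodicity\<close>

text \<open>The vector \<open>x i\<close> is the witness for the segment of length \<open>i\<close>.
  Segments of length at most 1 come without a witness; the condition is then empty and 0
  serves.\<close>

lemma branch_ergodic_tree:
  assumes "\<And>n. map b [0..<n] \<in> ergodic_tree T \<epsilon>"
  shows "strict_mono b"
    and "\<exists>x. \<forall>i. x i \<in> cball 0 1 \<and>
      (\<forall>p. Suc p < i \<longrightarrow> norm (cesaro T (b p) (x i) - cesaro T (b (Suc p)) (x i)) > \<epsilon>)"
proof -
  have "b n < b (Suc n)" for n
    using assms[of "Suc (Suc n)"] by (simp add: ergodic_tree_def sorted_wrt_append)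
  then show "strict_mono b"
    by (rule strict_monoI_Suc)
  have "\<exists>x. x \<in> cball 0 1 \<and>
      (\<forall>p. Suc p < i \<longrightarrow> norm (cesaro T (b p) x - cesaro T (b (Suc p)) x) > \<epsilon>)" for i
  proof (cases "i \<le> 1")
    case True
    then show ?thesis by (intro exI[of _ 0]) auto
  next
    case False
    then show ?thesis
      using assms[of i] by (auto simp: ergodic_tree_def)
  qed
  then show "\<exists>x. \<forall>i. x i \<in> cball 0 1 \<and>
      (\<forall>p. Suc p < i \<longrightarrow> norm (cesaro T (b p) (x i) - cesaro T (b (Suc p)) (x i)) > \<epsilon>)"
    by (rule choice[OF allI])
qed

lemma super_ergodic_imp_well_founded_tree:
  fixes T :: "'a :: real_normed_vector \<Rightarrow> 'a"
  assumes T: "bounded_linear T" and "super_ergodic T" and "\<epsilon> > 0"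
  shows "well_founded_tree (ergodic_tree T \<epsilon>)"
proof (rule ccontr)
  assume "\<not> well_founded_tree (ergodic_tree T \<epsilon>)"
  then obtain b where b: "\<And>n. map b [0..<n] \<in> ergodic_tree T \<epsilon>"
    by (auto simp: well_founded_tree_def)
  obtain f where f: "\<And>i. f i \<in> cball 0 1"
      "\<And>i p. Suc p < i \<Longrightarrow> norm (cesaro T (b p) (f i) - cesaro T (b (Suc p)) (f i)) > \<epsilon>"
    using branch_ergodic_tree(2)[OF b] by blast
  have "f \<in> bcontfun"
    unfolding bcontfun_def using f(1) by (auto simp: continuous_on_discrete intro!: boundedI[of _ 1])
  then obtain x where x: "apply_bcontfun x = f"
    by (metis Bcontfun_inverse)
  \<comment> \<open>An ultrafilter finer than \<open>sequentially\<close> is free, so it contains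
    every cofinite set.\<close>
  obtain U :: "nat filter" where U: "ultrafilter U" "U \<le> sequentially"
    using ex_ultrafilter_le[OF sequentially_bot] by blast
  then have "U \<noteq> bot"
    by (simp add: ultrafilter_def)
  let ?M = "null_sequences U :: (nat \<Rightarrow>\<^sub>C 'a) set" and ?A = "cesaro (sequence_map T)"
  have "nsp_ergodic (quotient_nspace ?M) (quotient_map ?M (sequence_map T))"
    using assms(2) U(1) by (auto simp: super_ergodic_def ultrapower_def ultrapower_map_def[abs_def])
  then obtain w where "(\<lambda>n. infdist (?A n x - w) ?M) \<longlonglongrightarrow> 0"
    using nsp_ergodic_quotientD[OF subspace_null_sequences linear_sequence_map[OF T]
        sequence_map_null_sequences[OF T]] by blast
  then have "\<forall>\<^sub>F n in sequentially. infdist (?A n x - w) ?M < \<epsilon> / 2"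
    using \<open>\<epsilon> > 0\<close> by (intro order_tendstoD(2)) auto
  then obtain p where p: "\<And>n. n \<ge> p \<Longrightarrow> infdist (?A n x - w) ?M < \<epsilon> / 2"
    by (auto simp: eventually_sequentially)
  \<comment> \<open>Both indices lie in the range where the means are within
    \<open>\<epsilon> / 2\<close> of the limit.\<close>
  have "p \<le> b p" "p \<le> b (Suc p)"
    using branch_ergodic_tree(1)[OF b] strict_mono_imp_increasing le_trans
    by (metis, metis Suc_leD)
  then have "infdist (?A (b p) x - ?A (b (Suc p)) x) ?M < \<epsilon>"
    using p[of "b p"] p[of "b (Suc p)"]
      infdist_diff_triangle[OF subspace_null_sequences, of "?A (b p) x" "?A (b (Suc p)) x" U w]
      infdist_diff_commute[OF subspace_null_sequences, of w "?A (b (Suc p)) x" U] by linarith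
  moreover have "\<epsilon> \<le> infdist (?A (b p) x - ?A (b (Suc p)) x) ?M"
  proof (rule infdist_null_sequences_ge[OF \<open>U \<noteq> bot\<close>])
    \<comment> \<open>Only the finitely many \<open>i\<close> up to \<open>Suc p\<close> need not
      show the oscillation at \<open>p\<close>.\<close>
    have "\<forall>\<^sub>F i in U. Suc p < i"
      using U(2) eventually_gt_at_top filter_leD by blast
    then show "\<forall>\<^sub>F i in U. \<epsilon> \<le> norm (apply_bcontfun (?A (b p) x - ?A (b (Suc p)) x) i)"
      by (rule eventually_mono)
        (use f(2) in \<open>simp add: apply_cesaro_sequence_map[OF T] x less_imp_le\<close>)
  qed
  ultimately show False by simp
qed

text \<open>Each single oscillation of the class of \<open>x\<close> is visible on a set of
  coordinates in \<open>U\<close>. Finitely many such sets have a common point, so one coordinate is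
  a witness for a whole segment.\<close>

lemma cesaro_cauchy_of_well_founded_tree:
  fixes T :: "'a :: real_normed_vector \<Rightarrow> 'a"
  assumes T: "bounded_linear T" and wf: "\<And>\<epsilon>. \<epsilon> > 0 \<Longrightarrow> well_founded_tree (ergodic_tree T \<epsilon>)"
    and U: "ultrafilter U" and "e > 0"
  shows "\<exists>N. \<forall>m\<ge>N. \<forall>n\<ge>N. infdist (cesaro (sequence_map T) m x - cesaro (sequence_map T) n x)
    (null_sequences U) < e"
proof (rule ccontr)
  let ?M = "null_sequences U" and ?A = "\<lambda>n. cesaro (sequence_map T) n x"
  assume "\<not> (\<exists>N. \<forall>m\<ge>N. \<forall>n\<ge>N. infdist (?A m - ?A n) ?M < e)"
  then have far: "\<exists>m\<ge>N. \<exists>n\<ge>N. e \<le> infdist (?A m - ?A n) ?M" for N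
    by (meson not_le)
  \<comment> \<open>Of two late means at distance at least \<open>e\<close>, one is at least
    \<open>e / 2\<close> away from any given mean; hence the oscillation can be continued from
    whatever index was chosen last.\<close>
  have step: "\<exists>n\<ge>N. e / 2 \<le> infdist (?A k - ?A n) ?M" for k N
  proof -
    obtain m n where mn: "m \<ge> N" "n \<ge> N" "e \<le> infdist (?A m - ?A n) ?M"
      using far by blast
    then have "e \<le> infdist (?A k - ?A m) ?M + infdist (?A k - ?A n) ?M"
      using infdist_diff_triangle[OF subspace_null_sequences, of "?A m" "?A n" U "?A k"]
        infdist_diff_commute[OF subspace_null_sequences, of "?A m" "?A k" U] by linarith
    then have "e / 2 \<le> infdist (?A k - ?A m) ?M \<or> e / 2 \<le> infdist (?A k - ?A n) ?M"
      by linarith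
    with mn show ?thesis by blast
  qed
  have "\<exists>b. \<forall>n. b n \<ge> 1 \<and> (b n < b (Suc n) \<and> e / 2 \<le> infdist (?A (b n) - ?A (b (Suc n))) ?M)"
  proof (rule dependent_nat_choice)
    show "\<exists>n::nat. n \<ge> 1" by blast
    show "\<exists>n\<ge>1. k < n \<and> e / 2 \<le> infdist (?A k - ?A n) ?M" for k
    proof -
      obtain n where "n \<ge> Suc k" "e / 2 \<le> infdist (?A k - ?A n) ?M"
        using step[of "Suc k" k] by blast
      then show ?thesis
        by (intro exI[of _ n]) auto
    qed
  qed
  then obtain b where b: "\<And>n. b n \<ge> 1" "strict_mono b"
      "\<And>n. e / 2 \<le> infdist (?A (b n) - ?A (b (Suc n))) ?M"
    by (metis strict_monoI_Suc)
  \<comment> \<open>Division by \<open>C\<close> brings every coordinate of \<open>x\<close> into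
    the unit ball; the summand 1 keeps \<open>C\<close> positive for \<open>x = 0\<close>.\<close>
  define C where "C = norm x + 1"
  have "C > 0"
    by (simp add: C_def add_nonneg_pos)
  \<comment> \<open>This makes \<open>C * \<epsilon> = e / 4\<close>, strictly less than the
    oscillation \<open>e / 2\<close> along \<open>b\<close>.\<close>
  define \<epsilon> where "\<epsilon> = e / (4 * C)"
  have "\<epsilon> > 0"
    using \<open>e > 0\<close> \<open>C > 0\<close> by (simp add: \<epsilon>_def)
  have large: "\<forall>\<^sub>F i in U. norm (apply_bcontfun (?A (b p) - ?A (b (Suc p))) i) > C * \<epsilon>" for p
  proof (rule ccontr)
    assume "\<not> ?thesis"
    \<comment> \<open>This is where \<open>U\<close> has to be an ultrafilter: an event that fails
      to hold eventually has a complement that does.\<close>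
    then have "\<forall>\<^sub>F i in U. \<not> norm (apply_bcontfun (?A (b p) - ?A (b (Suc p))) i) > C * \<epsilon>"
      using U unfolding ultrafilter_def by blast
    then have "\<forall>\<^sub>F i in U. norm (apply_bcontfun (?A (b p) - ?A (b (Suc p))) i) \<le> C * \<epsilon>"
      by (simp add: not_less)
    then have "infdist (?A (b p) - ?A (b (Suc p))) ?M \<le> C * \<epsilon>"
      using \<open>C > 0\<close> \<open>\<epsilon> > 0\<close> by (intro infdist_null_sequences_le) auto
    with b(3)[of p] \<open>C > 0\<close> \<open>e > 0\<close> show False
      by (simp add: \<epsilon>_def)
  qed
  have "map b [0..<n] \<in> ergodic_tree T \<epsilon>" for n
  proof -
    have "\<forall>\<^sub>F i in U. \<forall>p\<in>{..<n}. norm (apply_bcontfun (?A (b p) - ?A (b (Suc p))) i) > C * \<epsilon>"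
      using large by (intro eventually_ball_finite) auto
    moreover have "U \<noteq> bot"
      using U by (simp add: ultrafilter_def)
    ultimately obtain i where
      i: "\<And>p. p < n \<Longrightarrow> norm (apply_bcontfun (?A (b p) - ?A (b (Suc p))) i) > C * \<epsilon>"
      using eventually_happens' by fastforce
    define y where "y = (1 / C) *\<^sub>R apply_bcontfun x i"
    have "y \<in> cball 0 1"
      using norm_bounded[of x i] \<open>C > 0\<close> by (simp add: y_def C_def)
    have y_far: "norm (cesaro T (b p) y - cesaro T (b (Suc p)) y) > \<epsilon>" if "p < n" for p
    proof -
      let ?d = "apply_bcontfun (?A (b p) - ?A (b (Suc p))) i"
      have eq: "cesaro T (b p) y - cesaro T (b (Suc p)) y = (1 / C) *\<^sub>R ?d"
        by (simp add: y_def apply_cesaro_sequence_map[OF T] scaleR_diff_right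
            linear_scale[OF linear_cesaro[OF bounded_linear.linear[OF T]]])
      have "\<epsilon> < norm ?d / C"
        using i[OF that] \<open>C > 0\<close> by (simp only: pos_less_divide_eq mult.commute)
      then show ?thesis
        unfolding eq using \<open>C > 0\<close> by simp
    qed
    have "\<exists>y\<in>cball 0 1. \<forall>p. Suc p < n \<longrightarrow>
        norm (cesaro T (b p) y - cesaro T (b (Suc p)) y) > \<epsilon>"
      using \<open>y \<in> cball 0 1\<close> by (intro bexI[of _ y]) (auto intro: y_far)
    moreover have "sorted_wrt (<) (map b [0..<n])"
      using strict_monoD[OF b(2)] by (simp add: sorted_wrt_iff_nth_less)
    ultimately show ?thesis
      using b(1) by (auto simp: ergodic_tree_def)
  qed
  then show False
    using wf[OF \<open>\<epsilon> > 0\<close>] by (auto simp: well_founded_tree_def)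
qed

text \<open>Pointwise boundedness comes from the Cauchy property for constant sequences in the
  ultrapower along a principal ultrafilter, which is a copy of the space itself.\<close>

lemma cesaro_uniformly_bounded:
  fixes T :: "'a :: banach \<Rightarrow> 'a"
  assumes T: "bounded_linear T" and wf: "\<And>\<epsilon>. \<epsilon> > 0 \<Longrightarrow> well_founded_tree (ergodic_tree T \<epsilon>)"
  obtains K where "K > 0" and "\<And>n x. norm (cesaro T n x) \<le> K * norm x"
proof (rule uniform_boundedness)
  show "bounded_linear (cesaro T n)" for n
    by (rule bounded_linear_cesaro[OF T])
  fix x
  define U :: "nat filter" where "U = principal {0}"
  have U: "ultrafilter U" "U \<noteq> bot"
    by (auto simp: ultrafilter_def U_def eventually_principal trivial_limit_def)
  let ?A = "\<lambda>n. cesaro (sequence_map T) n (const_bcontfun x)"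
  \<comment> \<open>For the principal ultrafilter at 0, only coordinate 0 counts in the distance to
    the null sequences.\<close>
  have "norm (cesaro T m x - cesaro T n x) \<le> infdist (?A m - ?A n) (null_sequences U)" for m n
    by (rule infdist_null_sequences_ge[OF U(2)])
      (simp add: U_def eventually_principal apply_cesaro_sequence_map[OF T] const_bcontfun.rep_eq)
  then have "Cauchy (\<lambda>n. cesaro T n x)"
    using cesaro_cauchy_of_well_founded_tree[OF T wf U(1), of _ "const_bcontfun x"]
    by (intro CauchyI) (meson le_less_trans)
  then obtain C where "\<And>n. norm (cesaro T n x) \<le> C"
    using cauchy_imp_bounded by (force simp: bounded_iff)
  then show "\<exists>C. \<forall>n. norm (cesaro T n x) \<le> C"
    by blast
qed (rule that)

lemma well_founded_tree_imp_super_ergodic: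
  fixes T :: "'a :: banach \<Rightarrow> 'a"
  assumes T: "bounded_linear T" and wf: "\<And>\<epsilon>. \<epsilon> > 0 \<Longrightarrow> well_founded_tree (ergodic_tree T \<epsilon>)"
  shows "super_ergodic T"
  unfolding super_ergodic_def ultrapower_def ultrapower_map_def[abs_def]
proof (intro allI impI)
  fix U :: "nat filter" assume U: "ultrafilter U"
  obtain K where K: "K > 0" "\<And>n x. norm (cesaro T n x) \<le> K * norm x"
    using cesaro_uniformly_bounded[OF T wf] by blast
  show "nsp_ergodic (quotient_nspace (null_sequences U))
      (quotient_map (null_sequences U :: (nat \<Rightarrow>\<^sub>C 'a) set) (sequence_map T))"
  proof (rule nsp_ergodic_quotientI[OF complete_UNIV_bcontfun subspace_null_sequences
        closed_null_sequences linear_sequence_map[OF T] sequence_map_null_sequences[OF T]])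
    show "K \<ge> 0"
      using K(1) by simp
    \<comment> \<open>The means act coordinatewise, so the supremum norm inherits the bound from
      \<open>T\<close>.\<close>
    show "norm (cesaro (sequence_map T) n x) \<le> K * norm x" for n x
    proof (rule norm_bound)
      fix i
      have "norm (cesaro T n (apply_bcontfun x i)) \<le> K * norm (apply_bcontfun x i)"
        by (rule K(2))
      also have "\<dots> \<le> K * norm x"
        using K(1) by (simp add: norm_bounded)
      finally show "norm (apply_bcontfun (cesaro (sequence_map T) n x) i) \<le> K * norm x"
        by (simp add: apply_cesaro_sequence_map[OF T])
    qed
  qed (rule cesaro_cauchy_of_well_founded_tree[OF T wf U])
qed

theorem theorem3p3:
  fixes T :: "'a :: banach \<Rightarrow> 'a"
  assumes infinite_dimensional: "\<not> (\<exists>B :: 'a set. finite B \<and> span B = UNIV)"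
    and bounded_operator: "bounded_linear T"
  shows "(super_ergodic T \<longleftrightarrow> (\<forall>\<epsilon>>0. well_founded_tree (ergodic_tree T \<epsilon>)))
       \<and> ((\<forall>\<epsilon>>0. well_founded_tree (ergodic_tree T \<epsilon>)) \<longleftrightarrow> ergodic_height T < omega1)"
  using super_ergodic_imp_well_founded_tree[OF bounded_operator]
    well_founded_tree_imp_super_ergodic[OF bounded_operator] ergodic_height_less_omega1_iff[of T]
  by blast

end
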